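(* Let $1<q\le 2$ and $q'=q/(q-1)$. Then the Besov space $B^\infty_{0,q}(\mathbb T)$ is continuously embedded in $\exp L^{q'}(\mathbb T)$; that is, $B^\infty_{0,q}(\mathbb T)\subset \exp L^{q'}(\mathbb T)$ and there is a constant $C$ (depending only on $q$ and the choice of $\Phi$ in the definition of the Besov norm) such that $\|f\|_{\exp L^{q'}(\mathbb T)}\le C\|f\|_{B^\infty_{0,q}}$ for all $f\in B^\infty_{0,q}(\mathbb T)$.
   Context: $\mathbb T=\mathbb R/\mathbb Z$, identified with $[0,1)$ with Lebesgue measure; functions on $\mathbb T$ are $1$-periodic functions on $\mathbb R$. For $\nu>0$, $\exp L^\nu(\mathbb T)$ is the space of measurable functions with finite norm $\|f\|_{\exp L^\nu(\mathbb T)}=\sup_{1\le p<\infty}p^{-1/\nu}\|f\|_{L^p(\mathbb T)}$. Fix an even $C^\infty$ function $\Phi=\phi_0$ on $\mathbb R$ with $\Phi(s)=1$ for $|s|\le 1$ and $\Phi$ supported in $(-2,2)$. For $k\ge1$ set $\phi_k(s)=\Phi(2^{-k}s)-\Phi(2^{-k+1}s)$. For a periodic distribution $f$ with Fourier coefficients $\widehat f(n)$ set $L_kf(x)=\sum_{n\in\mathbb Z}\phi_k(n)\widehat f(n)e^{2\pi i n x}$, $k\ge0$. The space $B^\infty_{0,q}=B^\infty_{0,q}(\mathbb T)$ consists of all periodic distributions $f$ with $\|f\|_{B^\infty_{0,q}}=\big(\sum_{k=0}^\infty\|L_kf\|_\infty^q\big)^{1/q}<\infty$. (The space does not depend on the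 choice of $\Phi$; for $q\le2$ its elements are locally integrable functions.) *)

theory Defs
  imports "HOL-Probability.Probability"
begin

section \<open>The circle and norms of functions on it\<close>

text \<open>Functions on the circle are 1-periodic functions on the reals; the circle carries
  Lebesgue measure on the fundamental domain [0,1).\<close>

definition periodic1 :: "(real \<Rightarrow> 'a) \<Rightarrow> bool" where
  "periodic1 f \<longleftrightarrow> (\<forall>x. f (x + 1) = f x)"

definition circle_measure :: "real measure" where
  "circle_measure = lebesgue_on {0..<1}"

text \<open>Real powers of extended nonnegative reals; only used with exponent \<open>a > 0\<close>.\<close>

definition epowr :: "ennreal \<Rightarrow> real \<Rightarrow> ennreal" where
  "epowr x a = (if x = top then top else ennreal (enn2real x powr a))"

definition Lp_norm :: "real \<Rightarrow> (real \<Rightarrow> complex) \<Rightarrow> ennreal" where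
  "Lp_norm p f = epowr (\<integral>\<^sup>+ x. ennreal (norm (f x) powr p) \<partial>circle_measure) (1 / p)"

definition Linf_norm :: "(real \<Rightarrow> complex) \<Rightarrow> ennreal" where
  "Linf_norm f = esssup circle_measure (\<lambda>x. ennreal (norm (f x)))"

definition expL_norm :: "real \<Rightarrow> (real \<Rightarrow> complex) \<Rightarrow> ennreal" where
  "expL_norm \<nu> f = (SUP p\<in>{1..}. ennreal (p powr (- 1 / \<nu>)) * Lp_norm p f)"

definition expL :: "real \<Rightarrow> (real \<Rightarrow> complex) set" where
  "expL \<nu> = {f. periodic1 f \<and> f \<in> borel_measurable lebesgue \<and> expL_norm \<nu> f < top}"

section \<open>Smooth functions and periodic distributions\<close>

definition nth_deriv :: "nat \<Rightarrow> (real \<Rightarrow> complex) \<Rightarrow> real \<Rightarrow> complex" where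
  "nth_deriv j f = ((\<lambda>g x. vector_derivative g (at x)) ^^ j) f"

definition smooth :: "(real \<Rightarrow> complex) \<Rightarrow> bool" where
  "smooth f \<longleftrightarrow> (\<forall>j x. nth_deriv j f differentiable at x)"

definition test_fun :: "(real \<Rightarrow> complex) \<Rightarrow> bool" where
  "test_fun \<psi> \<longleftrightarrow> smooth \<psi> \<and> periodic1 \<psi>"

text \<open>Periodic distributions are the continuous linear functionals on the smooth 1-periodic
  functions, continuity being with respect to the seminorms given by the suprema of the
  derivatives. Values outside the space of test functions are irrelevant.\<close>

definition periodic_distribution :: "((real \<Rightarrow> complex) \<Rightarrow> complex) \<Rightarrow> bool" where
  "periodic_distribution u \<longleftrightarrow>
     (\<forall>\<psi> \<eta>. test_fun \<psi> \<longrightarrow> test_fun \<eta> \<longrightarrow> u (\<lambda>x. \<psi> x + \<eta> x) = u \<psi> + u \<eta>) \<and>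
     (\<forall>c \<psi>. test_fun \<psi> \<longrightarrow> u (\<lambda>x. c * \<psi> x) = c * u \<psi>) \<and>
     (\<exists>N A. \<forall>\<psi>. test_fun \<psi> \<longrightarrow> norm (u \<psi>) \<le> A * (\<Sum>j\<le>N. SUP x. norm (nth_deriv j \<psi> x)))"

text \<open>The distribution \<open>u\<close> is (given by) the integrable function \<open>g\<close>; the pairing is bilinear.\<close>

definition distribution_is_fun :: "((real \<Rightarrow> complex) \<Rightarrow> complex) \<Rightarrow> (real \<Rightarrow> complex) \<Rightarrow> bool" where
  "distribution_is_fun u g \<longleftrightarrow> integrable circle_measure g \<and>
     (\<forall>\<psi>. test_fun \<psi> \<longrightarrow> u \<psi> = (\<integral>x. g x * \<psi> x \<partial>circle_measure))"

definition char_fun :: "int \<Rightarrow> real \<Rightarrow> complex" where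
  "char_fun n x = exp (2 * of_real pi * \<i> * of_int n * of_real x)"

definition fourier_coeff :: "((real \<Rightarrow> complex) \<Rightarrow> complex) \<Rightarrow> int \<Rightarrow> complex" where
  "fourier_coeff u n = u (char_fun (- n))"

section \<open>The Besov space\<close>

text \<open>The cutoff may be complex valued, which includes the real valued case. Its support is the
  closure of the set where it does not vanish.\<close>

definition admissible_cutoff :: "(real \<Rightarrow> complex) \<Rightarrow> bool" where
  "admissible_cutoff \<Phi> \<longleftrightarrow> smooth \<Phi> \<and> (\<forall>s. \<Phi> (- s) = \<Phi> s) \<and> (\<forall>s. \<bar>s\<bar> \<le> 1 \<longrightarrow> \<Phi> s = 1) \<and>
     closure {s. \<Phi> s \<noteq> 0} \<subseteq> {-2<..<2}"

definition dyadic_cutoff :: "(real \<Rightarrow> complex) \<Rightarrow> nat \<Rightarrow> real \<Rightarrow> complex" where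
  "dyadic_cutoff \<Phi> k s =
     (if k = 0 then \<Phi> s else \<Phi> (2 powi (- int k) * s) - \<Phi> (2 powi (- int k + 1) * s))"

text \<open>The sum has only finitely many nonzero terms.\<close>

definition LP_piece ::
  "(real \<Rightarrow> complex) \<Rightarrow> nat \<Rightarrow> ((real \<Rightarrow> complex) \<Rightarrow> complex) \<Rightarrow> real \<Rightarrow> complex" where
  "LP_piece \<Phi> k u x =
     (\<Sum>\<^sub>\<infinity>n. dyadic_cutoff \<Phi> k (real_of_int n) * fourier_coeff u n * char_fun n x)"

definition besov_norm :: "(real \<Rightarrow> complex) \<Rightarrow> real \<Rightarrow> ((real \<Rightarrow> complex) \<Rightarrow> complex) \<Rightarrow> ennreal" where
  "besov_norm \<Phi> q u = epowr (\<Sum>k. epowr (Linf_norm (LP_piece \<Phi> k u)) q) (1 / q)"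

definition besov_space :: "(real \<Rightarrow> complex) \<Rightarrow> real \<Rightarrow> ((real \<Rightarrow> complex) \<Rightarrow> complex) set" where
  "besov_space \<Phi> q = {u. periodic_distribution u \<and> besov_norm \<Phi> q u < top}"

end

theory Submission
  imports Defs
begin

text \<open>
  Write \<open>a\<^sub>k = \<parallel>L\<^sub>k f\<parallel>\<^sub>\<infinity>\<close>. The heart of the matter is a sub-Gaussian estimate: for every finite
  set of indices \<open>k\<close>, the function \<open>g = \<Sum> L\<^sub>k f\<close> behaves like a sum of independent random variables,
  \<open>\<integral> exp (Re (w g)) \<le> exp (\<bar>w\<bar> s + C \<bar>w\<bar>\<^sup>2 s\<^sup>2)\<close> with \<open>s\<^sup>2 = \<Sum> a\<^sub>k\<^sup>2\<close>
  (\<open>exponential_integral_Re\<close>). It is obtained from the dyadic martingale of \<open>g\<close>, whose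
  value on an interval of length \<open>2\<^sup>-\<^sup>j\<close> is the mean of \<open>g\<close>. The martingale difference
  contributed by the \<open>k\<close>-th piece is at most a constant times \<open>2\<^bsup>-\<bar>j-k\<bar>\<^esup> a\<^sub>k\<close>: for \<open>k \<le> j\<close> the piece
  hardly varies on the interval, by Bernstein's inequality; for \<open>k > j\<close> its mean
  nearly vanishes, because its primitive is small by Jackson's theorem. Schur's test then bounds the sum of
  the squared differences by \<open>\<Sum> a\<^sub>k\<^sup>2\<close>, and Azuma's argument (multiply the bounds
  \<open>cosh d \<le> exp (d\<^sup>2/2)\<close> over the scales) gives the estimate. Since the mean of a function
  over an interval is a difference quotient of its primitive, the martingale differences are second differences of
  primitives, and no conditional expectations occur.

  Let now \<open>A\<close> be the \<open>\<ell>\<^sup>q\<close> norm of \<open>a\<close> and let \<open>p \<ge> 1\<close>. Put \<open>\<tau> = A p\<^bsup>-1/q\<^esup>\<close>, so that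
  \<open>\<Sum> (a\<^sub>k/\<tau>)\<^sup>q \<le> p\<close>. Pieces with \<open>a\<^sub>k > \<tau>\<close> are summed trivially, as
  \<open>\<Sum> a\<^sub>k/\<tau> \<le> \<Sum> (a\<^sub>k/\<tau>)\<^sup>q \<le> p\<close> over them; for the others \<open>q \<le> 2\<close> gives
  \<open>\<Sum> (a\<^sub>k/\<tau>)\<^sup>2 \<le> p\<close>, and the sub-Gaussian estimate applies. Together,
  \<open>\<integral> exp (\<bar>g\<bar>/(2\<tau>)) \<le> 4 exp (C p)\<close>, hence \<open>\<parallel>g\<parallel>\<^sub>p\<close> is at most a constant times
  \<open>\<tau> p = A p\<^bsup>1-1/q\<^esup>\<close> (\<open>moment_bound\<close>), which is the asserted growth because \<open>1 - 1/q = 1/q'\<close>.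

  The same bound with \<open>p = 1\<close> makes the partial sums of \<open>\<Sum> L\<^sub>k f\<close> Cauchy in \<open>L\<^sup>1\<close>. A subsequence converges
  almost everywhere to a function, which inherits the moment bounds by Fatou's lemma
  (\<open>limit_function\<close>). It has the Fourier coefficients of \<open>f\<close>, and a distribution is determined by them: convolution
  with the Jackson kernel approximates a test function, with all its derivatives, by
  trigonometric polynomials (\<open>distribution_is_fun_if_characters\<close>).
\<close>

section \<open>Characters of the circle\<close>

lemma char_fun_cis: "char_fun n x = cis (2 * pi * of_int n * x)"
  by (simp add: char_fun_def cis_conv_exp algebra_simps)

lemma norm_char_fun [simp]: "norm (char_fun n x) = 1"
  by (simp add: char_fun_cis)

lemma char_fun_0 [simp]: "char_fun 0 x = 1"
  by (simp add: char_fun_def)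

lemma char_fun_add: "char_fun (m + n) x = char_fun m x * char_fun n x"
  by (simp add: char_fun_cis cis_mult algebra_simps)

lemma char_fun_index_diff: "char_fun (m - n) x = char_fun m x * char_fun (- n) x"
  using char_fun_add[of m "- n" x] by simp

lemma char_fun_diff: "char_fun n (x - t) = char_fun n x * char_fun (- n) t"
  by (simp add: char_fun_cis cis_mult algebra_simps)

lemma cnj_char_fun: "cnj (char_fun n x) = char_fun (- n) x"
  by (simp add: char_fun_cis cis_cnj)

lemma char_fun_periodic: "char_fun n (x + 1) = char_fun n x"
proof -
  have "char_fun n (x + 1) = char_fun n x * cis (2 * pi * of_int n)"
    by (simp add: char_fun_cis cis_mult algebra_simps)
  then show ?thesis by simp
qed

lemma char_fun_has_vector_derivative:
  "(char_fun n has_vector_derivative 2 * pi * \<i> * of_int n * char_fun n x) (at x within S)"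
proof -
  have "((\<lambda>z. exp (2 * of_real pi * \<i> * of_int n * z)) has_field_derivative
      2 * pi * \<i> * of_int n * char_fun n x) (at (of_real x))"
    by (auto intro!: derivative_eq_intros simp: char_fun_def)
  from has_vector_derivative_real_field[OF this, of S] show ?thesis
    by (simp add: char_fun_def [abs_def])
qed

lemma continuous_on_char_fun [continuous_intros]: "continuous_on S (char_fun n)"
  unfolding char_fun_def by (intro continuous_intros)

lemma integral_char_fun: "integral {0..1} (char_fun n) = (if n = 0 then 1 else 0)"
proof (cases "n = 0")
  case True
  then show ?thesis by (simp add: char_fun_def [abs_def])
next
  case False
  have "((\<lambda>x. 2 * pi * \<i> * of_int n * char_fun n x) has_integral (char_fun n 1 - char_fun n 0)) {0..1}"
    by (intro fundamental_theorem_of_calculus char_fun_has_vector_derivative) simp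
  moreover have "char_fun n 1 = char_fun n 0" using char_fun_periodic[of n 0] by simp
  ultimately have "((\<lambda>x. 2 * pi * \<i> * of_int n * char_fun n x) has_integral 0) {0..1}" by simp
  then have "((\<lambda>x. inverse (2 * pi * \<i> * of_int n) * (2 * pi * \<i> * of_int n * char_fun n x)) has_integral
       inverse (2 * pi * \<i> * of_int n) * 0) {0..1}"
    by (rule has_integral_mult_right)
  then have "(char_fun n has_integral 0) {0..1}" using False by (simp add: field_simps)
  then show ?thesis using False by (simp add: integral_unique)
qed

lemma integral_char_fun_convolution:
  "integral {0..1} (\<lambda>t. char_fun n t * char_fun l (x - t)) = (if n = l then char_fun n x else 0)"
proof -
  have "(\<lambda>t. char_fun n t * char_fun l (x - t)) = (\<lambda>t. char_fun l x * char_fun (n - l) t)"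
    by (simp add: char_fun_diff char_fun_index_diff fun_eq_iff)
  then show ?thesis by (simp add: integral_char_fun)
qed

section \<open>Squared trigonometric polynomials as kernels\<close>

text \<open>Both the Fejer and the Jackson kernel are squared moduli of trigonometric polynomials. This
  makes them nonnegative, and by Parseval's identity their total mass is a sum of squares.\<close>

definition sq_kernel :: "nat \<Rightarrow> (nat \<Rightarrow> real) \<Rightarrow> real \<Rightarrow> real" where
  "sq_kernel K c s = (cmod (\<Sum>j<K. of_real (c j) * char_fun (int j) s))\<^sup>2"

lemma sq_kernel_nonneg [simp]: "0 \<le> sq_kernel K c s"
  by (simp add: sq_kernel_def)

lemma continuous_on_char_fun_compose [continuous_intros]:
  "continuous_on S f \<Longrightarrow> continuous_on S (\<lambda>x. char_fun n (f x))"
  unfolding char_fun_def by (intro continuous_intros)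

lemma continuous_on_sq_kernel [continuous_intros]:
  "continuous_on S f \<Longrightarrow> continuous_on S (\<lambda>x. sq_kernel K c (f x))"
  unfolding sq_kernel_def by (intro continuous_intros)

lemma sq_kernel_expand:
  "of_real (sq_kernel K c s) =
    (\<Sum>i<K. \<Sum>j<K. of_real (c i * c j) * char_fun (int i - int j) s)"
proof -
  have "of_real (sq_kernel K c s) =
      (\<Sum>i<K. of_real (c i) * char_fun (int i) s) * cnj (\<Sum>j<K. of_real (c j) * char_fun (int j) s)"
    unfolding sq_kernel_def using complex_norm_square by simp
  also have "\<dots> = (\<Sum>i<K. \<Sum>j<K. of_real (c i * c j) * char_fun (int i - int j) s)"
    by (simp add: sum_product cnj_char_fun char_fun_index_diff mult_ac)
  finally show ?thesis .
qed

lemma integral_char_fun_sq_kernel: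
  "integral {0..1} (\<lambda>t. char_fun n t * (char_fun l (x - t) * of_real (sq_kernel K c (x - t))))
    = char_fun n x * (\<Sum>i<K. \<Sum>j<K. if n = l + int i - int j then of_real (c i * c j) else 0)"
proof -
  have "(\<lambda>t. char_fun n t * (char_fun l (x - t) * of_real (sq_kernel K c (x - t)))) =
    (\<lambda>t. \<Sum>i<K. \<Sum>j<K. of_real (c i * c j) * (char_fun n t * char_fun (l + int i - int j) (x - t)))"
    by (simp add: sq_kernel_expand sum_distrib_left char_fun_add char_fun_index_diff mult_ac)
  then have "integral {0..1} (\<lambda>t. char_fun n t * (char_fun l (x - t) * of_real (sq_kernel K c (x - t))))
    = integral {0..1} (\<lambda>t. \<Sum>i<K. \<Sum>j<K. of_real (c i * c j) * (char_fun n t * char_fun (l + int i - int j) (x - t)))"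
    by simp
  also have "\<dots> = (\<Sum>i<K. \<Sum>j<K. of_real (c i * c j) *
      integral {0..1} (\<lambda>t. char_fun n t * char_fun (l + int i - int j) (x - t)))"
    by (simp add: integral_sum integrable_sum integrable_continuous_interval continuous_intros)
  also have "\<dots> = (\<Sum>i<K. \<Sum>j<K. char_fun n x * (if n = l + int i - int j then of_real (c i * c j) else 0))"
    by (intro sum.cong refl) (simp add: integral_char_fun_convolution)
  finally show ?thesis by (simp add: sum_distrib_left)
qed

lemma integral_sq_kernel: "integral {0..1} (\<lambda>t. sq_kernel K c (x - t)) = (\<Sum>j<K. (c j)\<^sup>2)"
proof -
  have int: "(\<lambda>t. sq_kernel K c (x - t)) integrable_on {0..1}"
    by (intro integrable_continuous_interval continuous_intros)
  have "complex_of_real (integral {0..1} (\<lambda>t. sq_kernel K c (x - t))) =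
      integral {0..1} (\<lambda>t. complex_of_real (sq_kernel K c (x - t)))"
    using integral_linear[OF int bounded_linear_of_real[where 'a=complex]] by (simp add: o_def)
  also have "\<dots> = (\<Sum>i<K. \<Sum>j<K. if i = j then of_real (c i * c j) else 0)"
    using integral_char_fun_sq_kernel[of 0 0 x K c] by (simp cong: if_cong)
  also have "\<dots> = of_real (\<Sum>j<K. (c j)\<^sup>2)"
    by (simp add: power2_eq_square)
  finally show ?thesis using of_real_eq_iff by blast
qed

section \<open>Bernstein's inequality\<close>

text \<open>The double sum is the coefficient of the character \<open>n\<close> in the \<open>N\<close>-fold Fejer kernel
  modulated by the character \<open>N\<close>: a triangle centred at \<open>N\<close>, which is the identity on \<open>[0, N]\<close> and
  vanishes on \<open>[-N, 0]\<close>.\<close>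

lemma fejer_count:
  assumes "\<bar>n\<bar> \<le> int N"
  shows "(\<Sum>i<N. \<Sum>j<N. if n = int N + int i - int j then (1::complex) else 0) = of_int (max n 0)"
proof -
  have "(\<Sum>j<N. if n = int N + int i - int j then (1::complex) else 0) = (if int i < n then 1 else 0)"
    if "i < N" for i
  proof -
    have "(\<Sum>j<N. if n = int N + int i - int j then (1::complex) else 0) =
       (\<Sum>j<N. if j = nat (int N + int i - n) then (1::complex) else 0)"
      using that assms by (intro sum.cong refl) auto
    also have "\<dots> = (if int i < n then 1 else 0)"
      using that assms by auto
    finally show ?thesis .
  qed
  then have "(\<Sum>i<N. \<Sum>j<N. if n = int N + int i - int j then (1::complex) else 0)
      = (\<Sum>i<N. if int i < n then 1 else 0)" by simp
  also have "\<dots> = of_nat (card {i\<in>{..<N}. int i < n})"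
    by (simp add: sum.If_cases Int_def)
  also have "{i\<in>{..<N}. int i < n} = {..<nat n}"
    using assms by auto
  finally show ?thesis by (auto simp: max_def)
qed

lemma fejer_count_neg:
  assumes "\<bar>n\<bar> \<le> int N"
  shows "(\<Sum>i<N. \<Sum>j<N. if n = - int N + int i - int j then (1::complex) else 0) = of_int (max (- n) 0)"
proof -
  have "(\<Sum>i<N. \<Sum>j<N. if n = - int N + int i - int j then (1::complex) else 0) =
    (\<Sum>j<N. \<Sum>i<N. if - n = int N + int j - int i then (1::complex) else 0)"
    by (subst sum.swap) (intro sum.cong refl if_cong, auto)
  then show ?thesis using fejer_count[of "-n" N] assms by simp
qed

text \<open>The difference of the two modulated Fejer kernels has the multiplier \<open>n\<close> on \<open>[-N, N]\<close>, so
  that convolution with it differentiates, up to the factor \<open>2 \<pi> \<i>\<close>; its absolute value is at most twice a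
  kernel of mass \<open>N\<close>.\<close>

lemma Bernstein_inequality:
  fixes c :: "int \<Rightarrow> complex"
  assumes S: "finite S" "\<And>n. n \<in> S \<Longrightarrow> \<bar>n\<bar> \<le> int N"
    and bound: "\<And>x. cmod (\<Sum>n\<in>S. c n * char_fun n x) \<le> a"
  shows "cmod (\<Sum>n\<in>S. c n * (2 * pi * \<i> * of_int n * char_fun n x)) \<le> 4 * pi * N * a"
proof -
  define g where "g t = (\<Sum>n\<in>S. c n * char_fun n t)" for t
  define F where "F s = (char_fun (int N) s - char_fun (- int N) s) * of_real (sq_kernel N (\<lambda>_. 1) s)" for s
  have mult: "integral {0..1} (\<lambda>t. char_fun n t * F (x - t)) = of_int n * char_fun n x"
    if "n \<in> S" for n
  proof -
    have "integral {0..1} (\<lambda>t. char_fun n t * F (x - t)) =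
       integral {0..1} (\<lambda>t. char_fun n t * (char_fun (int N) (x - t) * of_real (sq_kernel N (\<lambda>_. 1) (x - t)))
         - char_fun n t * (char_fun (- int N) (x - t) * of_real (sq_kernel N (\<lambda>_. 1) (x - t))))"
      unfolding F_def by (simp add: algebra_simps)
    also have "\<dots> = integral {0..1} (\<lambda>t. char_fun n t * (char_fun (int N) (x - t) * of_real (sq_kernel N (\<lambda>_. 1) (x - t))))
         - integral {0..1} (\<lambda>t. char_fun n t * (char_fun (- int N) (x - t) * of_real (sq_kernel N (\<lambda>_. 1) (x - t))))"
      by (intro integral_diff integrable_continuous_interval continuous_intros)
    also have "\<dots> = char_fun n x * (of_int (max n 0) - of_int (max (- n) 0))"
      using fejer_count[of n N] fejer_count_neg[of n N] S(2)[OF that]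
      by (simp add: integral_char_fun_sq_kernel right_diff_distrib cong: if_cong)
    also have "of_int (max n 0) - of_int (max (- n) 0) = (of_int n :: complex)"
      by (simp add: max_def)
    finally show ?thesis by simp
  qed
  have "(\<Sum>n\<in>S. c n * (of_int n * char_fun n x)) = (\<Sum>n\<in>S. c n * integral {0..1} (\<lambda>t. char_fun n t * F (x - t)))"
    by (intro sum.cong refl) (simp add: mult)
  also have "\<dots> = integral {0..1} (\<lambda>t. g t * F (x - t))"
  proof -
    have "integral {0..1} (\<lambda>t. g t * F (x - t)) =
      integral {0..1} (\<lambda>t. \<Sum>n\<in>S. c n * (char_fun n t * F (x - t)))"
      by (simp add: g_def sum_distrib_right mult.assoc)
    also have "\<dots> = (\<Sum>n\<in>S. integral {0..1} (\<lambda>t. c n * (char_fun n t * F (x - t))))"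
      unfolding F_def using S(1)
      by (intro integral_sum integrable_continuous_interval continuous_intros)
    finally show ?thesis by simp
  qed
  finally have eq: "(\<Sum>n\<in>S. c n * (of_int n * char_fun n x)) = integral {0..1} (\<lambda>t. g t * F (x - t))" .
  have "cmod (integral {0..1} (\<lambda>t. g t * F (x - t))) \<le> integral {0..1} (\<lambda>t. 2 * a * sq_kernel N (\<lambda>_. 1) (x - t))"
  proof (rule integral_norm_bound_integral)
    show "(\<lambda>t. g t * F (x - t)) integrable_on {0..1}"
      unfolding g_def F_def by (intro integrable_continuous_interval continuous_intros)
    show "(\<lambda>t. 2 * a * sq_kernel N (\<lambda>_. 1) (x - t)) integrable_on {0..1}"
      by (intro integrable_continuous_interval continuous_intros)
    fix t :: real
    have "cmod (char_fun (int N) (x - t) - char_fun (- int N) (x - t)) \<le> 2"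
      by (rule order_trans[OF norm_triangle_ineq4]) simp
    then have "cmod (g t) * cmod (F (x - t)) \<le> a * (2 * sq_kernel N (\<lambda>_. 1) (x - t))"
      using bound[of t] unfolding F_def g_def norm_mult
      by (intro mult_mono) (auto intro: order_trans[OF norm_ge_zero])
    then show "cmod (g t * F (x - t)) \<le> 2 * a * sq_kernel N (\<lambda>_. 1) (x - t)"
      by (simp add: norm_mult)
  qed
  also have "\<dots> = 2 * a * N"
    by (simp add: integral_sq_kernel)
  finally have le: "cmod (\<Sum>n\<in>S. c n * (of_int n * char_fun n x)) \<le> 2 * a * N"
    by (simp add: eq)
  have "(\<Sum>n\<in>S. c n * (2 * pi * \<i> * of_int n * char_fun n x)) =
     2 * pi * \<i> * (\<Sum>n\<in>S. c n * (of_int n * char_fun n x))"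
    by (simp add: sum_distrib_left algebra_simps)
  then have "cmod (\<Sum>n\<in>S. c n * (2 * pi * \<i> * of_int n * char_fun n x)) =
     2 * pi * cmod (\<Sum>n\<in>S. c n * (of_int n * char_fun n x))"
    by (simp add: norm_mult)
  also have "\<dots> \<le> 2 * pi * (2 * a * N)"
    using le by (intro mult_left_mono) auto
  finally show ?thesis by (simp add: algebra_simps)
qed

section \<open>The Jackson kernel and low frequencies\<close>

text \<open>The tent \<open>1, 2, \<dots>, m, \<dots>, 2, 1\<close> has increments \<open>1\<close> or \<open>-1\<close>, which are tiny compared with
  its sum of squares. The value \<open>0\<close> beyond the last entry makes the final
  increment available by the same formula.\<close>

definition tent :: "nat \<Rightarrow> nat \<Rightarrow> real" where
  "tent m j = (if j < m then real (j + 1) else if j < 2 * m - 1 then real (2 * m - 1 - j) else 0)"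

definition jackson_mass :: "nat \<Rightarrow> real" where
  "jackson_mass m = (\<Sum>j<2 * m - 1. (tent m j)\<^sup>2)"

abbreviation jackson :: "nat \<Rightarrow> real \<Rightarrow> real" where
  "jackson m \<equiv> sq_kernel (2 * m - 1) (tent m)"

lemma jackson_mass_ge: "m ^ 3 \<le> 3 * jackson_mass m"
proof (cases "m = 0")
  case False
  have "(\<Sum>j<m. real ((j + 1)\<^sup>2)) = m * (m + 1) * (2 * m + 1) / 6"
    by (induction m) (auto simp: field_simps power2_eq_square)
  moreover have "(\<Sum>j<m. real ((j + 1)\<^sup>2)) = (\<Sum>j<m. (tent m j)\<^sup>2)"
    by (intro sum.cong) (auto simp: tent_def)
  moreover have "(\<Sum>j<m. (tent m j)\<^sup>2) \<le> jackson_mass m"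
    unfolding jackson_mass_def using False by (intro sum_mono2) auto
  ultimately have "real m + 3 * real m ^ 2 + 2 * real m ^ 3 \<le> 6 * jackson_mass m"
    by (simp add: field_simps power2_eq_square power3_eq_cube)
  moreover have "0 \<le> real m" "0 \<le> real m ^ 2" "0 \<le> real m ^ 3" by simp_all
  ultimately have "2 * real m ^ 3 \<le> 6 * jackson_mass m" by linarith
  then show ?thesis by simp
qed (simp add: jackson_mass_def)

lemma jackson_mass_pos: "m \<ge> 1 \<Longrightarrow> 0 < jackson_mass m"
  using jackson_mass_ge[of m] by (smt (verit) of_nat_1 of_nat_mono zero_less_power)

text \<open>As \<open>4 sin\<^sup>2 (\<pi> s)\<close> is the squared modulus of \<open>1 - e(s)\<close>, multiplication by it replaces
  the coefficients by their increments; the mass of the product thus measures how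
  strongly the kernel is concentrated at \<open>0\<close>.\<close>

lemma sin_sq_jackson:
  assumes "m \<ge> 1"
  shows "(sin (pi * s))\<^sup>2 * jackson m s = sq_kernel (2 * m) (\<lambda>j. tent m j - (if j = 0 then 0 else tent m (j - 1))) s / 4"
proof -
  define P where "P = (\<Sum>j<2*m-1. of_real (tent m j) * char_fun (int j) s)"
  have K: "2 * m = Suc (2 * m - 1)" using assms by simp
  have t0: "tent m (2 * m - 1) = 0" using assms by (simp add: tent_def)
  have P1: "P = (\<Sum>j<2*m. of_real (tent m j) * char_fun (int j) s)"
    unfolding P_def using t0 by (subst (2) K) simp
  have P2: "char_fun 1 s * P = (\<Sum>j<2*m. of_real (if j = 0 then 0 else tent m (j - 1)) * char_fun (int j) s)"
    unfolding P_def by (subst K, subst sum.lessThan_Suc_shift)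
      (simp add: sum_distrib_left char_fun_add[of 1] algebra_simps)
  have "(1 - char_fun 1 s) * P = P - char_fun 1 s * P" by (simp add: algebra_simps)
  also have "\<dots> = (\<Sum>j<2*m. of_real (tent m j - (if j = 0 then 0 else tent m (j - 1))) * char_fun (int j) s)"
    unfolding P2 unfolding P1 sum_subtractf[symmetric] by (simp add: algebra_simps)
  finally have "sq_kernel (2 * m) (\<lambda>j. tent m j - (if j = 0 then 0 else tent m (j - 1))) s
      = (cmod (1 - char_fun 1 s))\<^sup>2 * jackson m s"
    by (simp add: sq_kernel_def P_def flip: norm_mult power_mult_distrib)
  moreover have "(cmod (1 - char_fun 1 s))\<^sup>2 = 4 * (sin (pi * s))\<^sup>2"
  proof -
    have "(cmod (1 - char_fun 1 s))\<^sup>2 = (1 - cos (2 * (pi * s)))\<^sup>2 + (sin (2 * (pi * s)))\<^sup>2"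
      by (simp add: char_fun_cis cmod_power2 mult.assoc)
    also have "\<dots> = 2 - 2 * cos (2 * (pi * s))"
      using sin_cos_squared_add[of "2 * (pi * s)"] by (simp add: power2_eq_square algebra_simps)
    also have "\<dots> = 4 * (sin (pi * s))\<^sup>2"
      by (simp add: cos_double cos_squared_eq)
    finally show ?thesis .
  qed
  ultimately show ?thesis by simp
qed

lemma integral_sin_sq_jackson:
  assumes "m \<ge> 1"
  shows "integral {0..1} (\<lambda>t. (sin (pi * (x - t)))\<^sup>2 * jackson m (x - t)) = m / 2"
proof -
  have "(\<Sum>j<2*m. (tent m j - (if j = 0 then 0 else tent m (j - 1)))\<^sup>2) = (\<Sum>j<2*m. (1::real))"
  proof (intro sum.cong refl)
    fix j assume "j \<in> {..<2*m}"
    then have "tent m j - (if j = 0 then 0 else tent m (j - 1)) \<in> {1, -1}"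
      using assms by (cases "j = 0"; cases "j < m"; cases "j = m"; cases "j = 2 * m - 1")
        (auto simp: tent_def of_nat_diff)
    then show "(tent m j - (if j = 0 then 0 else tent m (j - 1)))\<^sup>2 = 1" by auto
  qed
  then show ?thesis unfolding sin_sq_jackson[OF assms] by (simp add: integral_sq_kernel)
qed

text \<open>The kernel has first moment \<open>O(1/m)\<close> with respect to the periodic distance \<open>\<bar>sin (\<pi> s)\<bar>\<close>,
  because its second moment is \<open>O(1/m\<^sup>2)\<close>. Working with this distance avoids
  translating the interval of integration. The kernel is not normalized, hence the
  factors \<open>jackson_mass\<close>.\<close>

lemma jackson_approximation:
  fixes \<psi> :: "real \<Rightarrow> complex"
  assumes m: "m \<ge> 1" and cont: "continuous_on UNIV \<psi>"
    and lip: "\<And>t. cmod (\<psi> x - \<psi> t) \<le> L * \<bar>sin (pi * (x - t))\<bar>"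
  shows "cmod (\<psi> x * jackson_mass m - integral {0..1} (\<lambda>t. \<psi> t * jackson m (x - t)))
    \<le> 5 * L / (4 * m) * jackson_mass m"
proof -
  have L: "0 \<le> L"
    using order_trans[OF norm_ge_zero lip[of "x - 1/2"]] by simp
  have cont': "continuous_on {0..1} \<psi>" using cont continuous_on_subset by blast
  have J: "integral {0..1} (\<lambda>t. jackson m (x - t)) = jackson_mass m"
    by (simp add: integral_sq_kernel jackson_mass_def)
  have I: "((\<lambda>t. L / (2 * m) * jackson m (x - t)
      + L * m / 2 * ((sin (pi * (x - t)))\<^sup>2 * jackson m (x - t))) has_integral
      (L / (2 * m) * jackson_mass m + L * m / 2 * (m / 2))) {0..1}" 
  proof (intro has_integral_add has_integral_mult_right)
    have "(\<lambda>t. jackson m (x - t)) integrable_on {0..1}"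
      by (intro integrable_continuous_interval continuous_intros)
    then show "((\<lambda>t. jackson m (x - t)) has_integral jackson_mass m) {0..1}"
      unfolding J[symmetric] by (rule integrable_integral)
    have "(\<lambda>t. (sin (pi * (x - t)))\<^sup>2 * jackson m (x - t)) integrable_on {0..1}"
      by (intro integrable_continuous_interval continuous_intros)
    then show "((\<lambda>t. (sin (pi * (x - t)))\<^sup>2 * jackson m (x - t)) has_integral (m / 2)) {0..1}"
      unfolding integral_sin_sq_jackson[OF m, of x, symmetric] by (rule integrable_integral)
  qed
  have "(\<lambda>t. jackson m (x - t)) integrable_on {0..1}" 
    by (intro integrable_continuous_interval continuous_intros)
  from integral_linear[OF this bounded_linear_of_real[where 'a=complex]]
  have "integral {0..1} (\<lambda>t. complex_of_real (jackson m (x - t))) = jackson_mass m"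
    using J by (simp add: o_def)
  then have A: "\<psi> x * jackson_mass m = integral {0..1} (\<lambda>t. \<psi> x * jackson m (x - t))" by simp
  have eq: "\<psi> x * jackson_mass m - integral {0..1} (\<lambda>t. \<psi> t * jackson m (x - t))
     = integral {0..1} (\<lambda>t. (\<psi> x - \<psi> t) * jackson m (x - t))"
    unfolding A left_diff_distrib
    by (rule integral_diff[symmetric]) (rule integrable_continuous_interval, intro continuous_intros cont')+
  have "cmod (\<psi> x * jackson_mass m - integral {0..1} (\<lambda>t. \<psi> t * jackson m (x - t)))
      \<le> integral {0..1} (\<lambda>t. L / (2 * m) * jackson m (x - t)
      + L * m / 2 * ((sin (pi * (x - t)))\<^sup>2 * jackson m (x - t)))"
  unfolding eq proof (rule integral_norm_bound_integral)
    fix t :: real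
    let ?s = "\<bar>sin (pi * (x - t))\<bar>"
    \<comment> \<open>the arithmetic-geometric mean inequality, balanced at the width \<open>1/m\<close> of the kernel\<close>
    have "2 * m * ?s \<le> 1 + m\<^sup>2 * ?s\<^sup>2"
      using sum_squares_bound[of "m * ?s" 1] by (simp add: power_mult_distrib)
    then have s: "?s \<le> 1 / (2 * m) + m / 2 * ?s\<^sup>2"
      using m by (simp add: field_simps power2_eq_square)
    have "cmod ((\<psi> x - \<psi> t) * jackson m (x - t)) = cmod (\<psi> x - \<psi> t) * jackson m (x - t)"
      by (simp add: norm_mult)
    also have "\<dots> \<le> (L * (1 / (2 * m) + m / 2 * ?s\<^sup>2)) * jackson m (x - t)"
      using lip[of t] mult_left_mono[OF s L] by (intro mult_right_mono) auto
    finally show "cmod ((\<psi> x - \<psi> t) * jackson m (x - t)) \<le> L / (2 * m) * jackson m (x - t)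
      + L * m / 2 * ((sin (pi * (x - t)))\<^sup>2 * jackson m (x - t))"
      by (simp add: algebra_simps)
  next
    show "(\<lambda>t. (\<psi> x - \<psi> t) * jackson m (x - t)) integrable_on {0..1}"
      by (intro integrable_continuous_interval continuous_intros cont')
    show "(\<lambda>t. L / (2 * m) * jackson m (x - t)
      + L * m / 2 * ((sin (pi * (x - t)))\<^sup>2 * jackson m (x - t))) integrable_on {0..1}"
      using I by (rule has_integral_integrable)
  qed
  also have "\<dots> = L / (2 * m) * jackson_mass m + L * m / 2 * (m / 2)"
    using I by (rule integral_unique)
  also have "\<dots> \<le> 5 * L / (4 * m) * jackson_mass m"
  proof -
    have "L * m / 2 * (m / 2) = L / (4 * m) * m ^ 3"
      using m by (simp add: field_simps power3_eq_cube)
    also have "\<dots> \<le> L / (4 * m) * (3 * jackson_mass m)"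
      using jackson_mass_ge[of m] L by (intro mult_left_mono) auto
    finally have "L * m / 2 * (m / 2) \<le> L / (4 * m) * (3 * jackson_mass m)" .
    moreover have "5 * L / (4 * m) * jackson_mass m = L / (2 * m) * jackson_mass m + L / (4 * m) * (3 * jackson_mass m)"
      using m by (simp add: field_simps)
    ultimately show ?thesis by linarith
  qed
  finally show ?thesis .
qed

text \<open>Jordan's inequality, by concavity of the sine on \<open>[0, \<pi>/2]\<close>.\<close>

lemma sin_pi_ge:
  assumes "\<bar>y\<bar> \<le> 1 / 2"
  shows "2 * \<bar>y\<bar> \<le> \<bar>sin (pi * y)\<bar>"
proof -
  have pos: "2 * y \<le> sin (pi * y)" if "0 \<le> y" "y \<le> 1 / 2" for y :: real
  proof -
    have "convex_on {0..pi/2} (\<lambda>x. - sin x)"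
    proof (rule convex_on_realI)
      show "((\<lambda>x. - sin x) has_real_derivative - cos x) (at x)" for x :: real
        by (auto intro!: derivative_eq_intros)
    next
      fix x y :: real assume "x \<in> {0..pi/2}" "y \<in> {0..pi/2}" "x \<le> y"
      then show "- cos x \<le> - cos y" using cos_monotone_0_pi_le[of x y] by auto
    qed auto
    from convex_onD[OF this, of "2 * y" 0 "pi/2"] that
    show ?thesis by (simp add: algebra_simps)
  qed
  show ?thesis
    using pos[of "\<bar>y\<bar>"] assms by (cases "y \<ge> 0") auto
qed

lemma periodic1_of_int:
  assumes "periodic1 f"
  shows "f (x + of_int k) = f x"
proof -
  have nat: "f (x + of_nat n) = f x" for x n
  proof (induction n)
    case (Suc n)
    then show ?case using assms by (simp add: periodic1_def add.assoc[symmetric] add.commute[of 1])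
  qed simp
  show ?thesis
  proof (cases "k \<ge> 0")
    case True
    then show ?thesis using nat[of x "nat k"] by simp
  next
    case False
    then show ?thesis using nat[of "x + of_int k" "nat (- k)"] by simp
  qed
qed

lemma Lipschitz_vector_derivative:
  fixes f :: "real \<Rightarrow> 'a::real_normed_vector"
  assumes "\<And>x. (f has_vector_derivative f' x) (at x)" "\<And>x. norm (f' x) \<le> L"
  shows "norm (f x - f y) \<le> L * \<bar>x - y\<bar>"
proof -
  have "norm (f x - f y) \<le> L * norm (x - y)"
  proof (rule differentiable_bound[OF convex_UNIV, where f' = "\<lambda>x h. h *\<^sub>R f' x"])
    show "onorm (\<lambda>h. h *\<^sub>R f' x) \<le> L" for x
      by (rule onorm_le) (simp add: mult.commute[of L] mult_left_mono assms(2))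
  qed (use assms(1) in \<open>auto simp: has_vector_derivative_def\<close>)
  then show ?thesis by simp
qed

lemma periodic_Lipschitz_sin:
  fixes f :: "real \<Rightarrow> complex"
  assumes per: "periodic1 f" and lip: "\<And>x y. cmod (f x - f y) \<le> L * \<bar>x - y\<bar>"
  shows "cmod (f x - f t) \<le> L / 2 * \<bar>sin (pi * (x - t))\<bar>"
proof -
  define k where "k = round (x - t)"
  define y where "y = x - t - of_int k"
  have y: "\<bar>y\<bar> \<le> 1 / 2"
    using of_int_round_abs_le[of "x - t"] by (simp add: y_def k_def abs_minus_commute)
  have L: "0 \<le> L" using order_trans[OF norm_ge_zero lip[of 1 0]] by simp
  have "f x = f (t + y)"
    using periodic1_of_int[OF per, of "t + y" k] by (simp add: y_def)
  then have "cmod (f x - f t) \<le> L * \<bar>y\<bar>"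
    using lip[of "t + y" t] by simp
  also have "\<dots> \<le> L / 2 * \<bar>sin (pi * y)\<bar>"
    using mult_left_mono[OF sin_pi_ge[OF y] L] by simp
  also have "periodic1 (\<lambda>y::real. \<bar>sin (pi * y)\<bar>)"
    by (simp add: periodic1_def distrib_left)
  from periodic1_of_int[OF this, of y k] have "\<bar>sin (pi * y)\<bar> = \<bar>sin (pi * (x - t))\<bar>"
    by (simp add: y_def)
  finally show ?thesis .
qed

lemma jackson_approximation_C1:
  fixes \<psi> :: "real \<Rightarrow> complex"
  assumes m: "m \<ge> 1" and per: "periodic1 \<psi>"
    and deriv: "\<And>x. (\<psi> has_vector_derivative \<psi>' x) (at x)" and bound: "\<And>x. cmod (\<psi>' x) \<le> L"
  shows "cmod (\<psi> x * jackson_mass m - integral {0..1} (\<lambda>t. \<psi> t * jackson m (x - t)))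
    \<le> 5 * L / (8 * m) * jackson_mass m"
proof -
  have "continuous_on UNIV \<psi>"
    by (rule continuous_on_vector_derivative) (use deriv in auto)
  from jackson_approximation[OF m this periodic_Lipschitz_sin[OF per
      Lipschitz_vector_derivative[OF deriv bound]]]
  show ?thesis by simp
qed

text \<open>For \<open>n = 0\<close> the primitive is not periodic; it carries the mean of the function.\<close>

definition char_primitive :: "int \<Rightarrow> real \<Rightarrow> complex" where
  "char_primitive n x = (if n = 0 then of_real x else char_fun n x / (2 * pi * \<i> * of_int n))"

lemma char_primitive_has_vector_derivative:
  "(char_primitive n has_vector_derivative char_fun n x) (at x within T)"
proof (cases "n = 0")
  case True
  then show ?thesis
    using has_vector_derivative_real_field[of "\<lambda>x. x" 1 x T] DERIV_ident
    by (simp add: char_primitive_def [abs_def])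
next
  case False
  have "((\<lambda>x. char_fun n x / (2 * pi * \<i> * of_int n)) has_vector_derivative
      (2 * pi * \<i> * of_int n * char_fun n x) / (2 * pi * \<i> * of_int n)) (at x within T)"
    by (intro has_vector_derivative_divide char_fun_has_vector_derivative)
  with False show ?thesis by (simp add: char_primitive_def [abs_def])
qed

lemma trig_primitive_has_vector_derivative:
  "((\<lambda>x. \<Sum>n\<in>S. c n * char_primitive n x) has_vector_derivative (\<Sum>n\<in>S. c n * char_fun n x)) (at x within T)"
  by (intro has_vector_derivative_sum has_vector_derivative_mult_right char_primitive_has_vector_derivative)

lemma trig_has_vector_derivative:
  "((\<lambda>x. \<Sum>n\<in>S. c n * char_fun n x) has_vector_derivative
    (\<Sum>n\<in>S. c n * (2 * pi * \<i> * of_int n * char_fun n x))) (at x within T)"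
  by (intro has_vector_derivative_sum has_vector_derivative_mult_right char_fun_has_vector_derivative)

text \<open>The Jackson kernel of degree below \<open>N\<close> annihilates the primitive, so the error of
  the Jackson approximation is the primitive itself.\<close>

lemma high_frequency_primitive_bound:
  fixes c :: "int \<Rightarrow> complex"
  assumes S: "finite S" "\<And>n. n \<in> S \<Longrightarrow> int N \<le> \<bar>n\<bar>" and N: "N \<ge> 1"
    and bound: "\<And>x. cmod (\<Sum>n\<in>S. c n * char_fun n x) \<le> a"
  shows "cmod (\<Sum>n\<in>S. c n * char_primitive n x) \<le> 5 * a / (4 * N)"
proof -
  define G where "G x = (\<Sum>n\<in>S. c n * char_primitive n x)" for x
  have G: "G x = (\<Sum>n\<in>S. c n / (2 * pi * \<i> * of_int n) * char_fun n x)" for x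
    unfolding G_def using S(2) N by (intro sum.cong refl) (force simp: char_primitive_def)
  \<comment> \<open>the largest \<open>m\<close> for which the degree \<open>2 m - 2\<close> of the kernel stays below \<open>N\<close>\<close>
  define m where "m = (N + 1) div 2"
  have m: "m \<ge> 1" "2 * m \<le> N + 1" "real N \<le> 2 * m"
    using N by (auto simp: m_def)
  have per: "periodic1 G"
    by (simp add: periodic1_def G char_fun_periodic)
  have "integral {0..1} (\<lambda>t. G t * jackson m (x - t)) =
      (\<Sum>n\<in>S. integral {0..1} (\<lambda>t. c n / (2 * pi * \<i> * of_int n) * (char_fun n t * jackson m (x - t))))"
    unfolding G sum_distrib_right mult.assoc
    by (intro integral_sum integrable_continuous_interval continuous_intros S(1))
  also have "\<dots> = 0"
  proof (intro sum.neutral ballI)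
    fix n assume "n \<in> S"
    then have "(\<Sum>i<2*m-1. \<Sum>j<2*m-1. if n = 0 + int i - int j then of_real (tent m i * tent m j) else 0)
       = (0::complex)"
      using S(2)[of n] m by (intro sum.neutral ballI) auto
    then have "integral {0..1} (\<lambda>t. char_fun n t * jackson m (x - t)) = 0"
      using integral_char_fun_sq_kernel[of n 0 x "2 * m - 1" "tent m"] by simp
    then show "integral {0..1} (\<lambda>t. c n / (2 * pi * \<i> * of_int n) * (char_fun n t * jackson m (x - t))) = 0"
      by (simp only: integral_mult_right mult_zero_right)
  qed
  finally have zero: "integral {0..1} (\<lambda>t. G t * jackson m (x - t)) = 0" .
  have "cmod (G x * jackson_mass m - integral {0..1} (\<lambda>t. G t * jackson m (x - t)))
    \<le> 5 * a / (8 * m) * jackson_mass m"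
    using m(1) per trig_primitive_has_vector_derivative[of c S, folded G_def] bound
    by (rule jackson_approximation_C1)
  moreover have M: "0 < jackson_mass m" by (rule jackson_mass_pos[OF m(1)])
  ultimately have "cmod (G x) * jackson_mass m \<le> 5 * a / (8 * m) * jackson_mass m"
    unfolding zero by (simp add: norm_mult)
  then have "cmod (G x) \<le> 5 * a / (8 * m)"
    using M by (rule mult_right_le_imp_le)
  also have "\<dots> \<le> 5 * a / (4 * N)"
    using m N order_trans[OF norm_ge_zero bound[of 0]] 
    by (intro frac_le) auto
  finally show ?thesis by (simp add: G_def)
qed

section \<open>Exponential integrals by dyadic halving\<close>

lemma second_difference_bound:
  fixes G :: "real \<Rightarrow> complex"
  assumes G: "\<And>x. (G has_vector_derivative g x) (at x)"
    and lip: "\<And>x y. cmod (g x - g y) \<le> L * \<bar>x - y\<bar>"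
  shows "cmod (G (x + 2 * h) - 2 * G (x + h) + G x) \<le> L * h\<^sup>2"
proof -
  define H where "H t = G (t + h) - G t" for t
  have H: "(H has_vector_derivative (g (t + h) - g t)) (at t)" for t
  proof -
    have "((G \<circ> (\<lambda>t. t + h)) has_vector_derivative (1 *\<^sub>R g (t + h))) (at t)"
      by (rule vector_diff_chain_at) (use G in \<open>auto intro!: derivative_eq_intros\<close>)
    then show ?thesis unfolding H_def [abs_def] using G[of t]
      by (auto intro!: has_vector_derivative_diff simp: o_def)
  qed
  have "cmod (g (t + h) - g t) \<le> L * \<bar>h\<bar>" for t
    using lip[of "t + h" t] by simp
  from Lipschitz_vector_derivative[OF H this, of "x + h" x]
  show ?thesis by (simp add: H_def power2_eq_square algebra_simps)
qed

text \<open>This is \<open>cosh d \<le> exp (d\<^sup>2/2)\<close> for \<open>d = (t - s)/2\<close>, and an instance of Hoeffding's lemma.\<close>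

lemma exp_midpoint_le:
  "exp s + exp t \<le> 2 * exp ((s + t) / 2 + ((t - s) / 2)\<^sup>2 / 2)" for s t :: real
proof (induction s t rule: linorder_wlog)
  case (le s t)
  define h where "h = t - s"
  have "0 < 1 + 1 / 2 * (exp h - 1)" using exp_gt_zero[of h] by argo
  moreover have "ln (1 + 1 / 2 * (exp h - 1)) \<le> h / 2 + h\<^sup>2 / 8"
  proof -
    have "- h * (1 / 2) + ln (1 + 1 / 2 * (exp h - 1)) \<le> h\<^sup>2 / 8"
      using Hoeffdings_lemma_aux[of h "1/2"] le by (simp add: h_def)
    then show ?thesis by linarith
  qed
  ultimately have "1 + 1 / 2 * (exp h - 1) \<le> exp (h / 2 + h\<^sup>2 / 8)"
    by (metis exp_le_cancel_iff exp_ln)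
  then have "1 + exp h \<le> 2 * exp (h / 2 + h\<^sup>2 / 8)" by argo
  then have "exp s * (1 + exp h) \<le> exp s * (2 * exp (h / 2 + h\<^sup>2 / 8))"
    by (intro mult_left_mono) auto
  moreover have "exp s * (1 + exp h) = exp s + exp t"
    by (simp add: h_def distrib_left flip: exp_add)
  moreover have "s + (h / 2 + h\<^sup>2 / 8) = (s + t) / 2 + ((t - s) / 2)\<^sup>2 / 2"
    by (simp add: h_def field_simps power2_eq_square)
  then have "exp s * (2 * exp (h / 2 + h\<^sup>2 / 8)) = 2 * exp ((s + t) / 2 + ((t - s) / 2)\<^sup>2 / 2)"
    by (metis exp_add mult.left_commute)
  ultimately show ?case by linarith
next
  case (sym s t)
  then show ?case using power2_commute[of s t] by (simp add: add.commute power_divide)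
qed

text \<open>Azuma's inequality for the dyadic martingale of \<open>f\<close>. The mean of \<open>f\<close> over an interval is the slope
  of \<open>F\<close>; halving the interval splits the slope into slopes \<open>s\<close> and \<open>t\<close> whose half difference is the
  second difference of \<open>F\<close>, and costs a factor \<open>exp (\<beta>\<^sub>j\<^sup>2/2)\<close>. At the finest scale \<open>J\<close> the function
  differs from its slope by at most \<open>L 2\<^sup>-\<^sup>J\<close>.\<close>

lemma dyadic_exponential_integral:
  fixes F f :: "real \<Rightarrow> real"
  assumes deriv: "\<And>x. (F has_real_derivative f x) (at x)"
    and lip: "\<And>x y. \<bar>f x - f y\<bar> \<le> L * \<bar>x - y\<bar>"
    and second: "\<And>j x. \<bar>F (x + 2 * (1/2) ^ Suc j) - 2 * F (x + (1/2) ^ Suc j) + F x\<bar> \<le> \<beta> j * (1/2) ^ j"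
    and "j \<le> J"
  shows "integral {x..x + (1/2) ^ j} (\<lambda>t. exp (f t)) \<le>
    (1/2) ^ j * exp ((F (x + (1/2) ^ j) - F x) / (1/2) ^ j + (\<Sum>i=j..<J. (\<beta> i)\<^sup>2) / 2 + L * (1/2) ^ J)"
  using \<open>j \<le> J\<close>
proof (induction arbitrary: x rule: inc_induct)
  case base
  define l :: real where "l = (1/2) ^ J"
  have l: "0 < l" by (simp add: l_def)
  have L: "0 \<le> L" using order_trans[OF abs_ge_zero lip[of 1 0]] by simp
  have contf: "continuous_on T f" for T
    by (rule lipschitz_on_continuous_on[of L]) (use lip L in \<open>auto simp: lipschitz_on_def dist_real_def\<close>)
  obtain z where z: "x < z" "z < x + l" "F (x + l) - F x = (x + l - x) * f z"
    using MVT2[of x "x + l" F f] deriv l by auto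
  have "integral {x..x + l} (\<lambda>t. exp (f t)) \<le> integral {x..x + l} (\<lambda>t. exp ((F (x + l) - F x) / l + L * l))"
  proof (rule integral_le)
    fix t assume t: "t \<in> {x..x + l}"
    have "f t \<le> f z + L * \<bar>t - z\<bar>" using lip[of t z] by linarith
    also have "\<dots> \<le> f z + L * l" using t z L by (intro add_left_mono mult_left_mono) auto
    also have "f z = (F (x + l) - F x) / l" using z l by simp
    finally show "exp (f t) \<le> exp ((F (x + l) - F x) / l + L * l)" by simp
  qed (intro integrable_continuous_interval continuous_intros contf)+
  also have "\<dots> = l * exp ((F (x + l) - F x) / l + L * l)"
    using l by simp
  finally show ?case by (simp add: l_def)
next
  case (step j)
  define h :: real where "h = (1/2) ^ Suc j"
  have h: "0 < h" "(1/2) ^ j = 2 * h" by (auto simp: h_def)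
  have L: "0 \<le> L" using order_trans[OF abs_ge_zero lip[of 1 0]] by simp
  have contf: "continuous_on T f" for T
    by (rule lipschitz_on_continuous_on[of L]) (use lip L in \<open>auto simp: lipschitz_on_def dist_real_def\<close>)
  define B where "B = (\<Sum>i=Suc j..<J. (\<beta> i)\<^sup>2) / 2 + L * (1/2) ^ J"
  define s where "s = (F (x + h) - F x) / h"
  define t where "t = (F (x + 2 * h) - F (x + h)) / h"
  have sum: "(\<Sum>i=j..<J. (\<beta> i)\<^sup>2) / 2 + L * (1/2) ^ J = (\<beta> j)\<^sup>2 / 2 + B"
    using step.hyps by (simp add: B_def sum.atLeast_Suc_lessThan add_divide_distrib)
  have IH: "integral {x..x + h} (\<lambda>t. exp (f t)) \<le> h * exp ((F (x + h) - F x) / h + B)" for x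
    using step.IH[of x] by (simp add: B_def add.assoc h_def)
  have "\<bar>(t - s) / 2\<bar> = \<bar>F (x + 2 * h) - 2 * F (x + h) + F x\<bar> / (2 * h)"
    using h(1) by (simp add: s_def t_def diff_divide_distrib[symmetric] abs_divide algebra_simps)
  also have "\<dots> \<le> \<beta> j"
  proof -
    have "\<bar>F (x + 2 * h) - 2 * F (x + h) + F x\<bar> \<le> \<beta> j * (2 * h)"
      using second[of x j] unfolding h(2) by (simp only: h_def)
    then show ?thesis using h(1) by (simp add: divide_le_eq)
  qed
  finally have "((t - s) / 2)\<^sup>2 \<le> (\<beta> j)\<^sup>2" by (metis abs_le_square_iff abs_of_nonneg abs_ge_zero order_trans)
  then have d: "exp ((s + t) / 2 + ((t - s) / 2)\<^sup>2 / 2) \<le> exp ((s + t) / 2 + (\<beta> j)\<^sup>2 / 2)"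
    by simp
  have "integral {x..x + 2 * h} (\<lambda>t. exp (f t)) =
     integral {x..x + h} (\<lambda>t. exp (f t)) + integral {x + h..x + 2 * h} (\<lambda>t. exp (f t))"
    using h(1) by (intro Henstock_Kurzweil_Integration.integral_combine[symmetric] integrable_continuous_interval continuous_intros contf) auto
  also have "\<dots> \<le> h * exp (s + B) + h * exp (t + B)"
    using IH[of x] IH[of "x + h"] by (simp add: s_def t_def algebra_simps)
  also have "\<dots> = h * exp B * (exp s + exp t)"
    by (simp add: exp_add algebra_simps)
  also have "\<dots> \<le> h * exp B * (2 * exp ((s + t) / 2 + (\<beta> j)\<^sup>2 / 2))"
  proof (rule mult_left_mono)
    show "exp s + exp t \<le> 2 * exp ((s + t) / 2 + (\<beta> j)\<^sup>2 / 2)"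
      using exp_midpoint_le[of s t] d by linarith
  qed (use h(1) in simp)
  also have "\<dots> = 2 * h * exp ((s + t) / 2 + ((\<beta> j)\<^sup>2 / 2 + B))"
    by (simp add: exp_add algebra_simps)
  also have "(s + t) / 2 = (F (x + 2 * h) - F x) / (2 * h)"
    by (simp add: s_def t_def add_divide_distrib[symmetric])
  finally show ?case by (simp only: h(2) add.assoc sum)
qed

section \<open>Sums of dyadic pieces\<close>

definition dyadic_block :: "nat \<Rightarrow> int set" where
  "dyadic_block k = {n. \<bar>n\<bar> \<le> 2 ^ (k + 1) \<and> (k \<ge> 1 \<longrightarrow> 2 ^ (k - 1) \<le> \<bar>n\<bar>)}"

lemma finite_dyadic_block [simp]: "finite (dyadic_block k)"
  by (rule finite_subset[of _ "{- (2 ^ (k + 1))..2 ^ (k + 1)}"]) (auto simp: dyadic_block_def)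

definition decay :: "nat \<Rightarrow> nat \<Rightarrow> real" where
  "decay j k = (1/2) ^ ((j - k) + (k - j))"

lemma decay_nonneg [simp]: "0 \<le> decay j k" by (simp add: decay_def)

lemma decay_sym: "decay j k = decay k j" by (simp add: decay_def add.commute)

lemma sum_decay_le:
  assumes "finite A" shows "(\<Sum>j\<in>A. decay j k) \<le> 3"
proof -
  obtain M where M: "A \<subseteq> {..<M}" using finite_nat_iff_bounded assms by blast
  have "(\<Sum>j<M. decay j k) \<le> (if M \<le> k then (1/2) ^ (k - M) else 3 - (1/2) ^ (M - 1 - k))"
  proof (induction M)
    case (Suc M)
    consider "Suc M \<le> k" | "M = k" | "M > k" by linarith
    then show ?case
    proof cases
      case 1
      then have "k - M = Suc (k - Suc M)" by simp
      with 1 Suc show ?thesis by (simp add: decay_def)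
    next
      case 2
      with Suc show ?thesis by (simp add: decay_def)
    next
      case 3
      then have "M - k = Suc (M - 1 - k)" by simp
      with 3 Suc show ?thesis by (simp add: decay_def)
    qed
  qed simp
  also have "\<dots> \<le> 3"
    using power_le_one[of "1/2::real" "k - M"] by simp
  finally have "(\<Sum>j<M. decay j k) \<le> 3" .
  moreover have "(\<Sum>j\<in>A. decay j k) \<le> (\<Sum>j<M. decay j k)"
    using M by (intro sum_mono2) auto
  ultimately show ?thesis by linarith
qed

text \<open>Schur's test: the rows and the columns of the matrix \<open>decay\<close> have sums at most \<open>3\<close>, so its
  operator norm on \<open>\<ell>\<^sup>2\<close> is at most \<open>3\<close>.\<close>

lemma decay_Schur:
  fixes a :: "nat \<Rightarrow> real"
  assumes K: "finite K" and J: "finite J"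
  shows "(\<Sum>j\<in>J. (\<Sum>k\<in>K. decay j k * a k)\<^sup>2) \<le> 9 * (\<Sum>k\<in>K. (a k)\<^sup>2)"
proof -
  have "(\<Sum>k\<in>K. decay j k * a k)\<^sup>2 \<le> 3 * (\<Sum>k\<in>K. decay j k * (a k)\<^sup>2)" for j
  proof -
    have "(\<Sum>k\<in>K. decay j k * a k)\<^sup>2 = (\<Sum>k\<in>K. sqrt (decay j k) * (sqrt (decay j k) * a k))\<^sup>2"
      by (simp flip: mult.assoc)
    also have "\<dots> \<le> (\<Sum>k\<in>K. (sqrt (decay j k))\<^sup>2) * (\<Sum>k\<in>K. (sqrt (decay j k) * a k)\<^sup>2)"
      by (rule Cauchy_Schwarz_ineq_sum)
    also have "\<dots> = (\<Sum>k\<in>K. decay j k) * (\<Sum>k\<in>K. decay j k * (a k)\<^sup>2)"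
      by (simp add: power_mult_distrib)
    also have "\<dots> \<le> 3 * (\<Sum>k\<in>K. decay j k * (a k)\<^sup>2)"
      using sum_decay_le[OF K, of j] by (intro mult_right_mono sum_nonneg) (auto simp: decay_sym[of j])
    finally show ?thesis .
  qed
  then have "(\<Sum>j\<in>J. (\<Sum>k\<in>K. decay j k * a k)\<^sup>2) \<le> (\<Sum>j\<in>J. 3 * (\<Sum>k\<in>K. decay j k * (a k)\<^sup>2))"
    by (rule sum_mono)
  also have "\<dots> = (\<Sum>k\<in>K. 3 * (\<Sum>j\<in>J. decay j k) * (a k)\<^sup>2)"
    by (simp add: sum_distrib_left sum_distrib_right mult_ac) (rule sum.swap)
  also have "\<dots> \<le> (\<Sum>k\<in>K. 9 * (a k)\<^sup>2)"
    using sum_decay_le[OF J] by (intro sum_mono mult_right_mono) (auto simp: algebra_simps)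
  finally show ?thesis by (simp add: sum_distrib_left)
qed

text \<open>The coefficients are arbitrary here: all that matters about a Littlewood-Paley piece is
  the frequency band in which it lives and a bound on its size.\<close>

locale dyadic_pieces =
  fixes c :: "nat \<Rightarrow> int \<Rightarrow> complex" and a :: "nat \<Rightarrow> real"
    and piece prim :: "nat \<Rightarrow> real \<Rightarrow> complex"
  defines "piece k x \<equiv> \<Sum>n\<in>dyadic_block k. c k n * char_fun n x"
    and "prim k x \<equiv> \<Sum>n\<in>dyadic_block k. c k n * char_primitive n x"
  assumes bound: "\<And>k x. cmod (piece k x) \<le> a k"
begin

lemma bound_nonneg: "0 \<le> a k"
  using order_trans[OF norm_ge_zero bound] .

lemma prim_deriv: "(prim k has_vector_derivative piece k x) (at x)"
  unfolding prim_def [abs_def] piece_def by (rule trig_primitive_has_vector_derivative)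

lemma continuous_on_piece [continuous_intros]:
  "continuous_on T f \<Longrightarrow> continuous_on T (\<lambda>x. piece k (f x))"
  unfolding piece_def by (intro continuous_intros)

lemma piece_Lipschitz:
  "cmod (piece k x - piece k y) \<le> 4 * pi * 2 ^ (k + 1) * a k * \<bar>x - y\<bar>"
proof (rule Lipschitz_vector_derivative)
  show "(piece k has_vector_derivative
    (\<Sum>n\<in>dyadic_block k. c k n * (2 * pi * \<i> * of_int n * char_fun n x))) (at x)" for x
    unfolding piece_def [abs_def] by (rule trig_has_vector_derivative)
  have "cmod (\<Sum>n\<in>dyadic_block k. c k n * (2 * pi * \<i> * of_int n * char_fun n x)) 
      \<le> 4 * pi * real (2 ^ (k + 1)) * a k" for x
    by (rule Bernstein_inequality[OF finite_dyadic_block _ bound[unfolded piece_def]]) (auto simp: dyadic_block_def)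
  then show "cmod (\<Sum>n\<in>dyadic_block k. c k n * (2 * pi * \<i> * of_int n * char_fun n x)) 
      \<le> 4 * pi * 2 ^ (k + 1) * a k" for x by simp
qed

text \<open>At scales \<open>2\<^sup>-\<^sup>j\<close> finer than the wave length \<open>2\<^sup>-\<^sup>k\<close> the piece is nearly constant and Bernstein's inequality
  is used; at coarser scales the oscillation makes the primitive itself small.\<close>

lemma prim_second_difference:
  "cmod (prim k (x + 2 * (1/2) ^ Suc j) - 2 * prim k (x + (1/2) ^ Suc j) + prim k x)
    \<le> 10 * decay j k * a k * (1/2) ^ j"
proof (cases "k \<le> j")
  case True
  have "cmod (prim k (x + 2 * (1/2) ^ Suc j) - 2 * prim k (x + (1/2) ^ Suc j) + prim k x)
    \<le> 4 * pi * 2 ^ (k + 1) * a k * ((1/2) ^ Suc j)\<^sup>2"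
    by (rule second_difference_bound[OF prim_deriv piece_Lipschitz])
  also have "\<dots> = 2 * pi * (2 ^ k * (1/2) ^ j) * a k * (1/2) ^ j"
    by (simp add: power2_eq_square field_simps)
  also have "2 ^ k * (1/2) ^ j = (1/2 :: real) ^ (j - k)"
    using True by (simp add: power_diff field_simps)
  also have "2 * pi * (1/2) ^ (j - k) * a k * (1/2) ^ j \<le> 10 * (1/2) ^ (j - k) * a k * (1/2) ^ j"
    using pi_less_4 bound_nonneg[of k] by (intro mult_right_mono) auto
  finally show ?thesis using True by (simp add: decay_def)
next
  case False
  have b: "cmod (prim k x) \<le> 5 * a k / (4 * 2 ^ (k - 1))" for x
  proof -
    have "cmod (prim k x) \<le> 5 * a k / real (4 * 2 ^ (k - 1))"
      unfolding prim_def
      by (rule high_frequency_primitive_bound[OF finite_dyadic_block _ _ bound[unfolded piece_def]])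
        (use False in \<open>auto simp: dyadic_block_def\<close>)
    then show ?thesis by simp
  qed
  have "cmod (prim k (x + 2 * (1/2) ^ Suc j) - 2 * prim k (x + (1/2) ^ Suc j) + prim k x)
     \<le> cmod (prim k (x + 2 * (1/2) ^ Suc j)) + 2 * cmod (prim k (x + (1/2) ^ Suc j)) + cmod (prim k x)"
    by (rule order_trans[OF norm_triangle_ineq] add_right_mono order_trans[OF norm_triangle_ineq4])+
       (simp add: norm_mult)
  also have "\<dots> \<le> 4 * (5 * a k / (4 * 2 ^ (k - 1)))"
    using b[of "x + 2 * (1/2) ^ Suc j"] b[of "x + (1/2) ^ Suc j"] b[of x] by linarith
  also have "\<dots> = 10 * (1/2) ^ k * a k"
    using False by (cases k) (auto simp: field_simps)
  also have "(1/2 :: real) ^ k = (1/2) ^ (k - j) * (1/2) ^ j"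
    using False by (simp flip: power_add)
  finally show ?thesis using False by (simp add: decay_def mult_ac)
qed

text \<open>The mean of a piece over the circle. Only the lowest band contains the frequency \<open>0\<close>.\<close>

lemma prim_increment: "cmod (prim k 1 - prim k 0) \<le> (if k = 0 then a 0 else 0)"
proof (cases "k = 0")
  case True
  then show ?thesis
    using Lipschitz_vector_derivative[OF prim_deriv bound, of 0 1 0] by simp
next
  case False
  have "char_fun n 1 = char_fun n 0" for n using char_fun_periodic[of n 0] by simp
  then have "prim k 1 = prim k 0"
    unfolding prim_def using False by (intro sum.cong refl) (auto simp: dyadic_block_def char_primitive_def)
  with False show ?thesis by simp
qed

text \<open>The sub-Gaussian estimate. The term linear in \<open>s\<close> comes from the mean, the quadratic one from the
  martingale differences.\<close>

lemma exponential_integral_Re: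
  assumes K: "finite K" and s: "0 \<le> s" "(\<Sum>k\<in>K. (a k)\<^sup>2) \<le> s\<^sup>2"
  shows "integral {0..1} (\<lambda>t. exp (Re (w * (\<Sum>k\<in>K. piece k t))))
    \<le> exp (cmod w * s + 450 * (cmod w)\<^sup>2 * s\<^sup>2)" (is "?I \<le> _")
proof -
  define f where "f t = Re (w * (\<Sum>k\<in>K. piece k t))" for t
  define F where "F t = Re (w * (\<Sum>k\<in>K. prim k t))" for t
  define L where "L = cmod w * (\<Sum>k\<in>K. 4 * pi * 2 ^ (k + 1) * a k)"
  define \<beta> where "\<beta> j = 10 * cmod w * (\<Sum>k\<in>K. decay j k * a k)" for j
  have deriv: "(F has_real_derivative f x) (at x)" for x
  proof -
    have "((\<lambda>t. w * (\<Sum>k\<in>K. prim k t)) has_vector_derivative w * (\<Sum>k\<in>K. piece k x)) (at x)"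
      by (intro has_vector_derivative_mult_right has_vector_derivative_sum prim_deriv)
    from bounded_linear.has_vector_derivative[OF bounded_linear_Re this]
    show ?thesis by (simp add: F_def [abs_def] f_def has_real_derivative_iff_has_vector_derivative)
  qed
  have lip: "\<bar>f x - f y\<bar> \<le> L * \<bar>x - y\<bar>" for x y
  proof -
    have "f x - f y = Re (w * (\<Sum>k\<in>K. piece k x - piece k y))"
      by (simp add: f_def sum_subtractf right_diff_distrib)
    also have "\<bar>\<dots>\<bar> \<le> cmod w * cmod (\<Sum>k\<in>K. piece k x - piece k y)"
      using abs_Re_le_cmod by (simp only: norm_mult[symmetric])
    also have "\<dots> \<le> cmod w * (\<Sum>k\<in>K. 4 * pi * 2 ^ (k + 1) * a k * \<bar>x - y\<bar>)"
      by (intro mult_left_mono sum_norm_le piece_Lipschitz) auto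
    finally show ?thesis by (simp add: L_def sum_distrib_right mult.assoc)
  qed
  have second: "\<bar>F (x + 2 * (1/2) ^ Suc j) - 2 * F (x + (1/2) ^ Suc j) + F x\<bar> \<le> \<beta> j * (1/2) ^ j" for j x
  proof -
    let ?D = "\<lambda>k. prim k (x + 2 * (1/2) ^ Suc j) - 2 * prim k (x + (1/2) ^ Suc j) + prim k x"
    have "F (x + 2 * (1/2) ^ Suc j) - 2 * F (x + (1/2) ^ Suc j) + F x = Re (w * (\<Sum>k\<in>K. ?D k))"
      by (simp only: F_def sum.distrib sum_subtractf sum_distrib_left[symmetric])
         (simp add: algebra_simps)
    also have "\<bar>\<dots>\<bar> \<le> cmod w * cmod (\<Sum>k\<in>K. ?D k)"
      using abs_Re_le_cmod by (simp only: norm_mult[symmetric])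
    also have "\<dots> \<le> cmod w * (\<Sum>k\<in>K. 10 * decay j k * a k * (1/2) ^ j)"
      by (intro mult_left_mono sum_norm_le prim_second_difference) auto
    finally show ?thesis by (simp add: \<beta>_def sum_distrib_left sum_distrib_right mult_ac)
  qed
  have sum\<beta>: "(\<Sum>j=0..<J. (\<beta> j)\<^sup>2) / 2 \<le> 450 * (cmod w)\<^sup>2 * s\<^sup>2" for J
  proof -
    have "(\<Sum>j=0..<J. (\<beta> j)\<^sup>2) = 100 * (cmod w)\<^sup>2 * (\<Sum>j=0..<J. (\<Sum>k\<in>K. decay j k * a k)\<^sup>2)"
      by (simp only: \<beta>_def power_mult_distrib sum_distrib_left[symmetric]) simp
    also have "\<dots> \<le> 100 * (cmod w)\<^sup>2 * (9 * (\<Sum>k\<in>K. (a k)\<^sup>2))"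
      by (intro mult_left_mono decay_Schur K) auto
    also have "\<dots> \<le> 100 * (cmod w)\<^sup>2 * (9 * s\<^sup>2)"
      using s by (intro mult_left_mono) auto
    finally show ?thesis by simp
  qed
  have mean: "F 1 - F 0 \<le> cmod w * s"
  proof -
    have "F 1 - F 0 = Re (w * (\<Sum>k\<in>K. prim k 1 - prim k 0))"
      by (simp add: F_def sum_subtractf right_diff_distrib)
    also have "\<dots> \<le> cmod w * cmod (\<Sum>k\<in>K. prim k 1 - prim k 0)"
      using complex_Re_le_cmod by (simp only: norm_mult[symmetric])
    also have "\<dots> \<le> cmod w * (\<Sum>k\<in>K. if k = 0 then a 0 else 0)"
      by (intro mult_left_mono sum_norm_le prim_increment) auto
    also have "(\<Sum>k\<in>K. if k = 0 then a 0 else 0) \<le> s"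
    proof (cases "0 \<in> K")
      case True
      then have "(a 0)\<^sup>2 \<le> (\<Sum>k\<in>K. (a k)\<^sup>2)" using K by (intro member_le_sum) auto
      with s have "(a 0)\<^sup>2 \<le> s\<^sup>2" by linarith
      then have "a 0 \<le> s" using s(1) by (rule power2_le_imp_le)
      then show ?thesis using K True by simp
    qed (use K s in simp)
    finally show ?thesis by (simp add: mult_left_mono)
  qed
  \<comment> \<open>\<open>L\<close> depends on the highest frequency, but its contribution disappears as \<open>J\<close> grows\<close>
  have le: "?I \<le> exp (cmod w * s + 450 * (cmod w)\<^sup>2 * s\<^sup>2 + L * (1/2) ^ J)" for J
  proof -
    have "?I \<le> exp (F 1 - F 0 + (\<Sum>j=0..<J. (\<beta> j)\<^sup>2) / 2 + L * (1/2) ^ J)"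
      using dyadic_exponential_integral[OF deriv lip second, of 0 J 0] by (simp add: f_def)
    also have "\<dots> \<le> exp (cmod w * s + 450 * (cmod w)\<^sup>2 * s\<^sup>2 + L * (1/2) ^ J)"
      using mean sum\<beta>[of J] by simp
    finally show ?thesis .
  qed
  have "(\<lambda>J. exp (cmod w * s + 450 * (cmod w)\<^sup>2 * s\<^sup>2 + L * (1/2) ^ J)) \<longlonglongrightarrow>
     exp (cmod w * s + 450 * (cmod w)\<^sup>2 * s\<^sup>2 + L * 0)"
    by (intro tendsto_intros LIMSEQ_power_zero) simp
  then show ?thesis
    using le by (intro LIMSEQ_le_const[of _ "exp (cmod w * s + 450 * (cmod w)\<^sup>2 * s\<^sup>2)"]) auto
qed

text \<open>Half the modulus of a complex number is at most the largest of \<open>\<plusminus>Re\<close> and \<open>\<plusminus>Im\<close>, which are the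
  real parts of its multiples by the powers of \<open>\<i>\<close>.\<close>

lemma exponential_integral_norm:
  assumes K: "finite K" and s: "0 \<le> s" "(\<Sum>k\<in>K. (a k)\<^sup>2) \<le> s\<^sup>2" and l: "0 \<le> l"
  shows "integral {0..1} (\<lambda>t. exp (l / 2 * cmod (\<Sum>k\<in>K. piece k t)))
    \<le> 4 * exp (l * s + 450 * l\<^sup>2 * s\<^sup>2)"
proof -
  define W where "W = {of_real l, of_real (- l), \<i> * l, - \<i> * l}"
  define g where "g t = (\<Sum>k\<in>K. piece k t)" for t
  have W: "finite W" "card W \<le> 4" "\<And>w. w \<in> W \<Longrightarrow> cmod w = l"
    using l by (auto simp: W_def norm_mult card_insert_if)
  have cont: "continuous_on {0..1} g"
    unfolding g_def by (intro continuous_intros)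
  have pt: "exp (l / 2 * cmod (g t)) \<le> (\<Sum>w\<in>W. exp (Re (w * g t)))" for t
  proof -
    have "cmod (g t) / 2 \<le> \<bar>Re (g t)\<bar> \<or> cmod (g t) / 2 \<le> \<bar>Im (g t)\<bar>"
      using cmod_le[of "g t"] by linarith
    then have "\<exists>w\<in>W. l * (cmod (g t) / 2) \<le> Re (w * g t)"
      using mult_left_mono[OF _ l, of "cmod (g t) / 2" "Re (g t)"]
       mult_left_mono[OF _ l, of "cmod (g t) / 2" "- Re (g t)"]
       mult_left_mono[OF _ l, of "cmod (g t) / 2" "Im (g t)"]
       mult_left_mono[OF _ l, of "cmod (g t) / 2" "- Im (g t)"]
      by (auto simp: W_def abs_if split: if_splits)
    then obtain w where w: "w \<in> W" "l * (cmod (g t) / 2) \<le> Re (w * g t)" by blast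
    then have "exp (l / 2 * cmod (g t)) \<le> exp (Re (w * g t))" by simp
    also have "\<dots> \<le> (\<Sum>w\<in>W. exp (Re (w * g t)))"
      using w(1) W(1) by (intro member_le_sum) auto
    finally show ?thesis .
  qed
  have "integral {0..1} (\<lambda>t. exp (l / 2 * cmod (g t))) \<le> integral {0..1} (\<lambda>t. \<Sum>w\<in>W. exp (Re (w * g t)))"
    using pt by (intro integral_le integrable_continuous_interval continuous_intros cont) auto
  also have "\<dots> = (\<Sum>w\<in>W. integral {0..1} (\<lambda>t. exp (Re (w * g t))))"
    using W(1) by (intro integral_sum integrable_continuous_interval continuous_intros cont)
  also have "\<dots> \<le> (\<Sum>w\<in>W. exp (l * s + 450 * l\<^sup>2 * s\<^sup>2))"
    using exponential_integral_Re[OF K s] W(3) by (intro sum_mono) (fastforce simp: g_def)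
  also have "\<dots> \<le> 4 * exp (l * s + 450 * l\<^sup>2 * s\<^sup>2)"
    using W(2) by simp
  finally show ?thesis by (simp add: g_def)
qed

text \<open>Split at the height \<open>\<tau>\<close> and put \<open>x = a\<^sub>k/\<tau>\<close>. Then \<open>x \<le> x\<^sup>q\<close> for the large pieces, which bounds
  their sum, and \<open>x\<^sup>2 \<le> x\<^sup>q\<close> for the small ones, which feeds the sub-Gaussian estimate.\<close>

lemma exponential_integral_lq:
  assumes K: "finite K" and q: "1 < q" "q \<le> 2" and \<tau>: "0 < \<tau>" and p: "1 \<le> p"
    and sum: "(\<Sum>k\<in>K. (a k / \<tau>) powr q) \<le> p"
  shows "integral {0..1} (\<lambda>t. exp (cmod (\<Sum>k\<in>K. piece k t) / (2 * \<tau>))) \<le> 4 * exp (452 * p)"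
proof -
  define B where "B = {k\<in>K. \<tau> < a k}"
  define S where "S = {k\<in>K. a k \<le> \<tau>}"
  have fin: "finite B" "finite S" and KBS: "K = B \<union> S" "B \<inter> S = {}"
    using K by (auto simp: B_def S_def)
  have nn: "0 \<le> (a k / \<tau>) powr q" for k by simp
  have "(\<Sum>k\<in>B. a k / \<tau>) \<le> (\<Sum>k\<in>B. (a k / \<tau>) powr q)"
  proof (rule sum_mono)
    fix k assume "k \<in> B"
    then have "1 \<le> a k / \<tau>" using \<tau> by (simp add: B_def)
    then show "a k / \<tau> \<le> (a k / \<tau>) powr q"
      using powr_mono[of 1 q "a k / \<tau>"] q \<tau> bound_nonneg[of k] by simp
  qed
  also have "\<dots> \<le> p" using sum_mono2[OF K, of B "\<lambda>k. (a k / \<tau>) powr q"] sum by (auto simp: B_def)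
  finally have big: "(\<Sum>k\<in>B. a k / \<tau>) \<le> p" .
  have "(\<Sum>k\<in>S. (a k / \<tau>)\<^sup>2) \<le> (\<Sum>k\<in>S. (a k / \<tau>) powr q)"
  proof (rule sum_mono)
    fix k assume "k \<in> S"
    then have x: "0 \<le> a k / \<tau>" "a k / \<tau> \<le> 1" using \<tau> bound_nonneg by (auto simp: S_def)
    show "(a k / \<tau>)\<^sup>2 \<le> (a k / \<tau>) powr q"
    proof (cases "a k / \<tau> = 0")
      case False
      then show ?thesis using powr_mono'[of q 2 "a k / \<tau>"] q x by (simp add: powr_numeral)
    qed (use \<tau> in auto)
  qed
  also have "\<dots> \<le> p" using sum_mono2[OF K, of S "\<lambda>k. (a k / \<tau>) powr q"] sum by (auto simp: S_def)
  finally have "(\<Sum>k\<in>S. (a k)\<^sup>2) / \<tau>\<^sup>2 \<le> p"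
    by (simp add: power_divide sum_divide_distrib)
  then have small: "(\<Sum>k\<in>S. (a k)\<^sup>2) \<le> (\<tau> * sqrt p)\<^sup>2"
    using \<tau> p by (simp add: field_simps power_mult_distrib)
  define gS where "gS t = (\<Sum>k\<in>S. piece k t)" for t
  have contS: "continuous_on {0..1} gS" unfolding gS_def by (intro continuous_intros)
  have "integral {0..1} (\<lambda>t. exp (cmod (\<Sum>k\<in>K. piece k t) / (2 * \<tau>)))
     \<le> integral {0..1} (\<lambda>t. exp (p / 2) * exp ((1 / \<tau>) / 2 * cmod (gS t)))"
  proof (rule integral_le)
    fix t
    have "cmod (\<Sum>k\<in>K. piece k t) \<le> cmod (\<Sum>k\<in>B. piece k t) + cmod (gS t)"
      unfolding KBS(1) gS_def using fin KBS(2) by (simp add: sum.union_disjoint norm_triangle_ineq)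
    also have "cmod (\<Sum>k\<in>B. piece k t) \<le> (\<Sum>k\<in>B. a k)"
      by (intro sum_norm_le bound)
    also have "(\<Sum>k\<in>B. a k) \<le> \<tau> * p"
      using big \<tau> by (simp add: field_simps flip: sum_divide_distrib)
    finally have "cmod (\<Sum>k\<in>K. piece k t) / (2 * \<tau>) \<le> (\<tau> * p + cmod (gS t)) / (2 * \<tau>)"
      using \<tau> by (intro divide_right_mono) auto
    also have "\<dots> = p / 2 + (1 / \<tau>) / 2 * cmod (gS t)"
      using \<tau> by (simp add: field_simps)
    finally show "exp (cmod (\<Sum>k\<in>K. piece k t) / (2 * \<tau>)) \<le> exp (p / 2) * exp ((1 / \<tau>) / 2 * cmod (gS t))"
      by (simp flip: exp_add)
  qed (intro integrable_continuous_interval continuous_intros contS; use \<tau> in simp)+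
  also have "\<dots> \<le> exp (p / 2) * (4 * exp (1 / \<tau> * (\<tau> * sqrt p) + 450 * (1 / \<tau>)\<^sup>2 * (\<tau> * sqrt p)\<^sup>2))"
    using exponential_integral_norm[OF fin(2) _ small, of "1 / \<tau>"] \<tau> p by (simp add: gS_def)
  also have "1 / \<tau> * (\<tau> * sqrt p) + 450 * (1 / \<tau>)\<^sup>2 * (\<tau> * sqrt p)\<^sup>2 = sqrt p + 450 * p"
    using \<tau> p by (simp add: power_mult_distrib power_divide)
  also have "exp (p / 2) * (4 * exp (sqrt p + 450 * p)) = 4 * exp (p / 2 + sqrt p + 450 * p)"
    by (simp only: exp_add mult_ac)
  also have "\<dots> \<le> 4 * exp (452 * p)"
  proof -
    have "sqrt p \<le> p" using p real_le_lsqrt[of p p] by (simp add: power2_eq_square real_le_lsqrt)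
    then show ?thesis using p by simp
  qed
  finally show ?thesis .
qed

lemma powr_le_exp:
  fixes y p \<tau> :: real
  assumes "0 \<le> y" "0 < \<tau>" "1 \<le> p"
  shows "y powr p \<le> (2 * p * \<tau>) powr p * exp (y / (2 * \<tau>))"
proof -
  have "y / (2 * p * \<tau>) \<le> exp (y / (2 * p * \<tau>))"
    using exp_ge_add_one_self[of "y / (2 * p * \<tau>)"] by linarith
  then have "(y / (2 * p * \<tau>)) powr p \<le> exp (y / (2 * p * \<tau>)) powr p"
    using assms by (intro powr_mono2) auto
  also have "exp (y / (2 * p * \<tau>)) powr p = exp (y / (2 * \<tau>))"
    using assms by (simp add: powr_def)
  finally have "(2 * p * \<tau>) powr p * (y / (2 * p * \<tau>)) powr p \<le> (2 * p * \<tau>) powr p * exp (y / (2 * \<tau>))"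
    by (intro mult_left_mono) auto
  also have "(2 * p * \<tau>) powr p * (y / (2 * p * \<tau>)) powr p = y powr p"
    using assms by (simp flip: powr_mult)
  finally show ?thesis .
qed

text \<open>The height \<open>\<tau> = A p\<^bsup>-1/q\<^esup>\<close> normalizes the \<open>q\<close>-th powers to have sum at most \<open>p\<close>, and then
  \<open>p \<tau> = A p\<^bsup>1-1/q\<^esup>\<close>.\<close>

lemma moment_bound:
  assumes K: "finite K" and q: "1 < q" "q \<le> 2" and p: "1 \<le> p" and A: "0 \<le> A"
    and sum: "(\<Sum>k\<in>K. a k powr q) \<le> A powr q"
  shows "integral {0..1} (\<lambda>t. cmod (\<Sum>k\<in>K. piece k t) powr p)
    \<le> (8 * exp 452 * A * p powr (1 - 1 / q)) powr p"
proof (cases "A = 0")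
  case True
  have "a k powr q \<le> 0 powr q" if "k \<in> K" for k
    by (rule order_trans[OF member_le_sum[OF that _ K] sum[unfolded True]]) simp
  then have "a k = 0" if "k \<in> K" for k
    using that by (fastforce simp: not_le[symmetric])
  then have "piece k t = 0" if "k \<in> K" for k t
    using that bound[of k t] by simp
  then have "(\<lambda>t. cmod (\<Sum>k\<in>K. piece k t) powr p) = (\<lambda>t. 0)" by simp
  then show ?thesis by simp
next
  case False
  with A have A: "0 < A" by simp
  define \<tau> where "\<tau> = A * p powr (- (1 / q))"
  have \<tau>: "0 < \<tau>" using A p by (simp add: \<tau>_def)
  have \<tau>q: "\<tau> powr q = A powr q / p"
    using A p q by (simp add: \<tau>_def powr_mult powr_powr powr_minus_divide powr_divide)
  have "(\<Sum>k\<in>K. (a k / \<tau>) powr q) = (\<Sum>k\<in>K. a k powr q) / \<tau> powr q"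
    using \<tau> bound_nonneg by (simp add: powr_divide sum_divide_distrib)
  also have "\<dots> \<le> A powr q / \<tau> powr q"
    using sum by (intro divide_right_mono) auto
  also have "\<dots> = p" using A p by (simp add: \<tau>q)
  finally have le: "(\<Sum>k\<in>K. (a k / \<tau>) powr q) \<le> p" .
  have cont: "continuous_on {0..1} (\<lambda>t. \<Sum>k\<in>K. piece k t)" by (intro continuous_intros)
  have "integral {0..1} (\<lambda>t. cmod (\<Sum>k\<in>K. piece k t) powr p)
     \<le> integral {0..1} (\<lambda>t. (2 * p * \<tau>) powr p * exp (cmod (\<Sum>k\<in>K. piece k t) / (2 * \<tau>)))"
  proof (rule integral_le)
    show "(\<lambda>t. cmod (\<Sum>k\<in>K. piece k t) powr p) integrable_on {0..1}"
      using p by (intro integrable_continuous_interval continuous_on_powr' continuous_intros cont) auto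
    show "(\<lambda>t. (2 * p * \<tau>) powr p * exp (cmod (\<Sum>k\<in>K. piece k t) / (2 * \<tau>))) integrable_on {0..1}"
      using \<tau> by (intro integrable_continuous_interval continuous_intros cont) auto
  qed (rule powr_le_exp[OF norm_ge_zero \<tau> p])
  also have "\<dots> \<le> (2 * p * \<tau>) powr p * (4 * exp (452 * p))"
    using exponential_integral_lq[OF K q \<tau> p le] by (simp add: mult_left_mono)
  also have "\<dots> \<le> (2 * p * \<tau>) powr p * (4 powr p * exp 452 powr p)"
    using p powr_mono[of 1 p 4] by (intro mult_left_mono mult_mono) (auto simp: powr_def mult.commute)
  also have "\<dots> = (8 * exp 452 * A * (p * p powr (- (1 / q)))) powr p"
    using \<tau> A p by (simp add: \<tau>_def flip: powr_mult) (simp add: algebra_simps)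
  also have "p * p powr (- (1 / q)) = p powr (1 - 1 / q)"
    using p powr_add[of p 1 "- (1 / q)"] by simp
  finally show ?thesis .
qed

end

section \<open>Continuous functions on the circle\<close>

lemma integrable_circle_continuous:
  fixes f :: "real \<Rightarrow> 'b::euclidean_space"
  assumes "continuous_on UNIV f"
  shows "integrable circle_measure f"
proof -
  have "f absolutely_integrable_on {0..1}"
    using assms by (intro absolutely_integrable_continuous_real) (rule continuous_on_subset, auto)
  then have "set_integrable lebesgue {0..<1} f"
    by (rule set_integrable_subset) auto
  then show ?thesis
    by (simp add: circle_measure_def set_integrable_def integrable_restrict_space)
qed

lemma integral_circle_continuous:
  fixes f :: "real \<Rightarrow> 'b::euclidean_space"
  assumes "continuous_on UNIV f"
  shows "(\<integral>x. f x \<partial>circle_measure) = integral {0..1} f"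
proof -
  have "(\<integral>x. f x \<partial>circle_measure) = integral {0..<1} f"
    using lebesgue_integral_eq_integral[OF integrable_circle_continuous[OF assms, unfolded circle_measure_def]]
    by (simp add: circle_measure_def)
  also have "\<dots> = integral {0..1} f"
  proof (rule integral_spike_set)
    show "negligible {x \<in> {0..<1} - {0..1}. f x \<noteq> 0}"
      by (rule negligible_subset[of "{}"]) auto
    show "negligible {x \<in> {0..1} - {0..<1}. f x \<noteq> 0}"
      by (rule negligible_subset[of "{1}"]) auto
  qed
  finally show ?thesis .
qed

lemma periodic_continuous_bounded:
  fixes f :: "real \<Rightarrow> complex"
  assumes "periodic1 f" "continuous_on UNIV f"
  obtains L where "\<And>x. cmod (f x) \<le> L"
proof -
  have "compact (f ` {0..1})"
    by (intro compact_continuous_image continuous_on_subset[OF assms(2)]) auto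
  from compact_imp_bounded[OF this] obtain L where "\<forall>y\<in>f ` {0..1}. cmod y \<le> L"
    by (auto simp: bounded_iff)
  then have L: "cmod (f x) \<le> L" if "x \<in> {0..1}" for x using that by simp
  have "cmod (f x) \<le> L" for x
  proof -
    have "f x = f (frac x)"
      using periodic1_of_int[OF assms(1), of "frac x" "\<lfloor>x\<rfloor>"] by (simp add: frac_def)
    then show ?thesis using L[of "frac x"] frac_lt_1[of x] by (simp add: less_imp_le)
  qed
  with that show ?thesis by blast
qed

section \<open>Test functions and trigonometric polynomials\<close>

lemma nth_deriv_0 [simp]: "nth_deriv 0 f = f"
  by (simp add: nth_deriv_def)

lemma nth_deriv_Suc: "nth_deriv (Suc j) f x = vector_derivative (nth_deriv j f) (at x)"
  by (simp add: nth_deriv_def)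

text \<open>Guessing the whole sequence of derivatives is more convenient than iterating.\<close>

lemma nth_deriv_eqI:
  assumes "\<And>x. F 0 x = f x" "\<And>j x. (F j has_vector_derivative F (Suc j) x) (at x)"
  shows "nth_deriv j f = F j"
proof (induction j)
  case (Suc j)
  then show ?case using assms(2) by (intro ext) (simp add: nth_deriv_Suc vector_derivative_at)
qed (use assms(1) in auto)

lemma smooth_nth_deriv:
  "smooth f \<Longrightarrow> (nth_deriv j f has_vector_derivative nth_deriv (Suc j) f x) (at x)"
  unfolding smooth_def nth_deriv_Suc by (simp add: vector_derivative_works)

lemma smoothI:
  assumes "\<And>x. F 0 x = f x" "\<And>j x. (F j has_vector_derivative F (Suc j) x) (at x)"
  shows "smooth f"
  unfolding smooth_def nth_deriv_eqI[of F f, OF assms]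
  using assms(2) differentiableI_vector by blast

lemma continuous_nth_deriv: "smooth f \<Longrightarrow> continuous_on S (nth_deriv j f)"
  by (rule continuous_on_vector_derivative) (use smooth_nth_deriv has_vector_derivative_at_within in blast)

lemma periodic_nth_deriv:
  assumes "test_fun f"
  shows "periodic1 (nth_deriv j f)"
proof (induction j)
  case (Suc j)
  have sm: "smooth f" using assms by (simp add: test_fun_def)
  show ?case unfolding periodic1_def
  proof
    fix x
    have "((nth_deriv j f \<circ> (\<lambda>t. t + 1)) has_vector_derivative (1 *\<^sub>R nth_deriv (Suc j) f (x + 1))) (at x)"
      by (rule vector_diff_chain_at) (use smooth_nth_deriv[OF sm] in \<open>auto intro!: derivative_eq_intros\<close>)
    moreover have "nth_deriv j f \<circ> (\<lambda>t. t + 1) = nth_deriv j f"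
      using Suc by (auto simp: periodic1_def)
    ultimately have "(nth_deriv j f has_vector_derivative nth_deriv (Suc j) f (x + 1)) (at x)" by simp
    then show "nth_deriv (Suc j) f (x + 1) = nth_deriv (Suc j) f x"
      using smooth_nth_deriv[OF sm] vector_derivative_unique_at by blast
  qed
qed (use assms in \<open>simp add: test_fun_def\<close>)

lemma nth_deriv_lincomb:
  assumes "smooth f" "smooth g"
  shows "nth_deriv j (\<lambda>x. f x + c * g x) = (\<lambda>x. nth_deriv j f x + c * nth_deriv j g x)"
  by (rule nth_deriv_eqI[where F="\<lambda>j x. nth_deriv j f x + c * nth_deriv j g x"])
     (auto intro!: has_vector_derivative_add has_vector_derivative_mult_right smooth_nth_deriv assms)

lemma test_fun_lincomb:
  assumes "test_fun f" "test_fun g"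
  shows "test_fun (\<lambda>x. f x + c * g x)"
  using assms unfolding test_fun_def
  by (auto intro!: smoothI[where F="\<lambda>j x. nth_deriv j f x + c * nth_deriv j g x"] has_vector_derivative_add
       has_vector_derivative_mult_right smooth_nth_deriv simp: periodic1_def)

lemma trig_power_has_vector_derivative:
  "((\<lambda>x. \<Sum>i\<in>I. c i * (2 * pi * \<i> * of_int (\<nu> i)) ^ j * char_fun (\<nu> i) x) has_vector_derivative
    (\<Sum>i\<in>I. c i * (2 * pi * \<i> * of_int (\<nu> i)) ^ Suc j * char_fun (\<nu> i) x)) (at x)"
proof -
  have "((\<lambda>x. \<Sum>i\<in>I. c i * (2 * pi * \<i> * of_int (\<nu> i)) ^ j * char_fun (\<nu> i) x) has_vector_derivative
    (\<Sum>i\<in>I. c i * (2 * pi * \<i> * of_int (\<nu> i)) ^ j * (2 * pi * \<i> * of_int (\<nu> i) * char_fun (\<nu> i) x))) (at x)"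
    by (intro has_vector_derivative_sum has_vector_derivative_mult_right char_fun_has_vector_derivative)
  then show ?thesis by (simp add: mult_ac)
qed

lemma nth_deriv_trig:
  "nth_deriv j (\<lambda>x. \<Sum>i\<in>I. c i * char_fun (\<nu> i) x) =
    (\<lambda>x. \<Sum>i\<in>I. c i * (2 * pi * \<i> * of_int (\<nu> i)) ^ j * char_fun (\<nu> i) x)"
  by (rule nth_deriv_eqI[where F="\<lambda>j x. \<Sum>i\<in>I. c i * (2 * pi * \<i> * of_int (\<nu> i)) ^ j * char_fun (\<nu> i) x"])
     (simp, rule trig_power_has_vector_derivative)

lemma test_fun_trig: "test_fun (\<lambda>x. \<Sum>i\<in>I. c i * char_fun (\<nu> i) x)"
  unfolding test_fun_def
  by (rule conjI, rule smoothI[where F="\<lambda>j x. \<Sum>i\<in>I. c i * (2 * pi * \<i> * of_int (\<nu> i)) ^ j * char_fun (\<nu> i) x"])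
     (simp, rule trig_power_has_vector_derivative, simp add: periodic1_def char_fun_periodic)

lemma test_fun_char: "test_fun (char_fun n)"
  using test_fun_trig[of "\<lambda>_. 1" "\<lambda>_. n" "{0::nat}"] by simp

section \<open>A periodic distribution is determined by its Fourier coefficients\<close>

definition fourier_integral :: "(real \<Rightarrow> complex) \<Rightarrow> int \<Rightarrow> complex" where
  "fourier_integral \<psi> n = integral {0..1} (\<lambda>t. \<psi> t * char_fun (- n) t)"

lemma fourier_integral_deriv:
  assumes per: "periodic1 \<psi>" and deriv: "\<And>x. (\<psi> has_vector_derivative \<psi>' x) (at x)"
    and cont: "continuous_on UNIV \<psi>'"
  shows "fourier_integral \<psi>' n = 2 * pi * \<i> * of_int n * fourier_integral \<psi> n"
proof -
  have cpsi: "continuous_on {0..1} \<psi>"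
    by (rule continuous_on_vector_derivative) (use deriv has_vector_derivative_at_within in blast)
  have cpsi': "continuous_on {0..1} \<psi>'" using cont continuous_on_subset by blast
  have "((\<lambda>t. \<psi> t * (2 * pi * \<i> * of_int (- n) * char_fun (- n) t) + \<psi>' t * char_fun (- n) t)
      has_integral (\<psi> 1 * char_fun (- n) 1 - \<psi> 0 * char_fun (- n) 0)) {0..1}"
    by (intro fundamental_theorem_of_calculus has_vector_derivative_mult
        char_fun_has_vector_derivative has_vector_derivative_at_within[OF deriv]) simp
  moreover have "\<psi> 1 = \<psi> 0" "char_fun (- n) 1 = char_fun (- n) 0"
    using per char_fun_periodic[of "- n" 0] by (auto simp: periodic1_def dest: spec[of _ 0])
  ultimately have "integral {0..1} (\<lambda>t. \<psi> t * (2 * pi * \<i> * of_int (- n) * char_fun (- n) t) + \<psi>' t * char_fun (- n) t) = 0"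
    by (simp add: integral_unique)
  also have "integral {0..1} (\<lambda>t. \<psi> t * (2 * pi * \<i> * of_int (- n) * char_fun (- n) t) + \<psi>' t * char_fun (- n) t)
     = integral {0..1} (\<lambda>t. \<psi> t * (2 * pi * \<i> * of_int (- n) * char_fun (- n) t)) + fourier_integral \<psi>' n"
    unfolding fourier_integral_def by (intro integral_add integrable_continuous_interval continuous_intros cpsi cpsi')
  also have "(\<lambda>t. \<psi> t * (2 * pi * \<i> * of_int (- n) * char_fun (- n) t)) =
     (\<lambda>t. (- (2 * pi * \<i> * of_int n)) * (\<psi> t * char_fun (- n) t))"
    by (simp add: mult_ac)
  also have "integral {0..1} \<dots> = - (2 * pi * \<i> * of_int n) * fourier_integral \<psi> n"
    unfolding fourier_integral_def by (rule integral_mult_right)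
  finally show ?thesis by (simp add: add_eq_0_iff)
qed

lemma fourier_integral_nth_deriv:
  assumes "test_fun \<psi>"
  shows "fourier_integral (nth_deriv j \<psi>) n = (2 * pi * \<i> * of_int n) ^ j * fourier_integral \<psi> n"
proof (induction j)
  case (Suc j)
  have sm: "smooth \<psi>" using assms by (simp add: test_fun_def)
  show ?case
    using fourier_integral_deriv[OF periodic_nth_deriv[OF assms] smooth_nth_deriv[OF sm] continuous_nth_deriv[OF sm]] Suc
    by simp
qed simp

text \<open>The convolution of \<open>\<psi>\<close> with the normalized Jackson kernel, written so that it is
  visibly a trigonometric polynomial.\<close>

definition jackson_poly :: "nat \<Rightarrow> (real \<Rightarrow> complex) \<Rightarrow> real \<Rightarrow> complex" where
  "jackson_poly m \<psi> x = (\<Sum>(i, j)\<in>{..<2*m-1} \<times> {..<2*m-1}.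
     of_real (tent m i * tent m j / jackson_mass m) * fourier_integral \<psi> (int i - int j) * char_fun (int i - int j) x)"

lemma jackson_poly_eq_convolution:
  fixes \<psi> :: "real \<Rightarrow> complex"
  assumes "continuous_on UNIV \<psi>"
  shows "integral {0..1} (\<lambda>t. \<psi> t * jackson m (x - t)) = jackson_mass m * jackson_poly m \<psi> x"
proof (cases "m \<ge> 1")
  case False
  then show ?thesis by (simp add: jackson_poly_def sq_kernel_def)
next
  case True
  have M: "0 < jackson_mass m" by (rule jackson_mass_pos[OF True])
  have cont: "continuous_on {0..1} \<psi>" using assms continuous_on_subset by blast
  have "(\<lambda>t. \<psi> t * jackson m (x - t)) = (\<lambda>t. \<Sum>i<2*m-1. \<Sum>j<2*m-1.
      of_real (tent m i * tent m j) * char_fun (int i - int j) x * (\<psi> t * char_fun (- (int i - int j)) t))"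
    unfolding sq_kernel_expand sum_distrib_left char_fun_diff by (simp add: mult_ac)
  then have "integral {0..1} (\<lambda>t. \<psi> t * jackson m (x - t)) =
     integral {0..1} (\<lambda>t. \<Sum>i<2*m-1. \<Sum>j<2*m-1.
      of_real (tent m i * tent m j) * char_fun (int i - int j) x * (\<psi> t * char_fun (- (int i - int j)) t))"
    by simp
  also have "\<dots> = (\<Sum>i<2*m-1. \<Sum>j<2*m-1. integral {0..1} (\<lambda>t. 
      of_real (tent m i * tent m j) * char_fun (int i - int j) x * (\<psi> t * char_fun (- (int i - int j)) t)))"
    by (subst integral_sum, simp, intro integrable_sum finite_lessThan integrable_continuous_interval continuous_intros cont,
        intro sum.cong refl integral_sum finite_lessThan integrable_continuous_interval continuous_intros cont)
  also have "\<dots> = (\<Sum>i<2*m-1. \<Sum>j<2*m-1. of_real (tent m i * tent m j) * char_fun (int i - int j) x * fourier_integral \<psi> (int i - int j))"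
    unfolding fourier_integral_def integral_mult_right ..
  also have "\<dots> = jackson_mass m * jackson_poly m \<psi> x"
    using M unfolding jackson_poly_def sum.cartesian_product sum_distrib_left by (auto intro!: sum.cong)
  finally show ?thesis .
qed

text \<open>Differentiation commutes with the convolution, since it multiplies the Fourier coefficients;
  so each derivative is approximated at the rate \<open>1/m\<close>.\<close>

lemma jackson_poly_approximation:
  assumes \<psi>: "test_fun \<psi>"
  obtains L where "\<And>m x. m \<ge> 1 \<Longrightarrow> cmod (nth_deriv j \<psi> x - nth_deriv j (jackson_poly m \<psi>) x) \<le> L / real m"
proof -
  have sm: "smooth \<psi>" using \<psi> by (simp add: test_fun_def)
  obtain L where L: "\<And>x. cmod (nth_deriv (Suc j) \<psi> x) \<le> L"
    using periodic_continuous_bounded[OF periodic_nth_deriv[OF \<psi>] continuous_nth_deriv[OF sm]] by blast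
  have "cmod (nth_deriv j \<psi> x - nth_deriv j (jackson_poly m \<psi>) x) \<le> (5 * L / 8) / m" if m: "m \<ge> 1" for m x
  proof -
    have M: "0 < jackson_mass m" by (rule jackson_mass_pos[OF m])
    have "nth_deriv j (jackson_poly m \<psi>) x = jackson_poly m (nth_deriv j \<psi>) x"
      using nth_deriv_trig[of j "\<lambda>(i, l). of_real (tent m i * tent m l / jackson_mass m) * fourier_integral \<psi> (int i - int l)"
          "\<lambda>(i, l). int i - int l" "{..<2*m-1} \<times> {..<2*m-1}"]
      unfolding jackson_poly_def [abs_def] by (auto simp: case_prod_unfold fourier_integral_nth_deriv[OF \<psi>] mult_ac)
    moreover have "cmod (nth_deriv j \<psi> x * jackson_mass m - integral {0..1} (\<lambda>t. nth_deriv j \<psi> t * jackson m (x - t)))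
        \<le> 5 * L / (8 * m) * jackson_mass m"
      by (rule jackson_approximation_C1[OF m periodic_nth_deriv[OF \<psi>] smooth_nth_deriv[OF sm] L])
    ultimately have "cmod (jackson_mass m * (nth_deriv j \<psi> x - nth_deriv j (jackson_poly m \<psi>) x))
       \<le> 5 * L / (8 * m) * jackson_mass m"
      unfolding jackson_poly_eq_convolution[OF continuous_nth_deriv[OF sm]] by (simp add: algebra_simps)
    then have "cmod (nth_deriv j \<psi> x - nth_deriv j (jackson_poly m \<psi>) x) * jackson_mass m \<le> 5 * L / (8 * m) * jackson_mass m"
      using M by (simp add: norm_mult mult.commute)
    from mult_right_le_imp_le[OF this M] show ?thesis by simp
  qed
  with that show ?thesis by blast
qed

lemma jackson_poly_trig:
  "jackson_poly m \<psi> = (\<lambda>x. \<Sum>i\<in>{..<2*m-1} \<times> {..<2*m-1}.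
     (case i of (i, j) \<Rightarrow> of_real (tent m i * tent m j / jackson_mass m) * fourier_integral \<psi> (int i - int j)) *
      char_fun (case i of (i, j) \<Rightarrow> int i - int j) x)"
  unfolding jackson_poly_def [abs_def] by (simp add: case_prod_unfold)

lemma periodic_distribution_trig:
  assumes u: "periodic_distribution u" and I: "finite I"
  shows "u (\<lambda>x. \<Sum>i\<in>I. c i * char_fun (\<nu> i) x) = (\<Sum>i\<in>I. c i * u (char_fun (\<nu> i)))"
proof -
  have add: "\<And>\<psi> \<eta>. test_fun \<psi> \<Longrightarrow> test_fun \<eta> \<Longrightarrow> u (\<lambda>x. \<psi> x + \<eta> x) = u \<psi> + u \<eta>"
    and mul: "\<And>c \<psi>. test_fun \<psi> \<Longrightarrow> u (\<lambda>x. c * \<psi> x) = c * u \<psi>"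
    using u by (auto simp: periodic_distribution_def)
  from I show ?thesis
  proof (induction I rule: finite_induct)
    case empty
    then show ?case using mul[OF test_fun_char, of 0 0] by simp
  next
    case (insert i I)
    have "test_fun (\<lambda>x. c i * char_fun (\<nu> i) x)"
      using test_fun_trig[of c \<nu> "{i}"] by simp
    with insert show ?case by (simp add: add test_fun_trig mul test_fun_char)
  qed
qed

text \<open>Both functionals agree on the Jackson approximants \<open>h\<close> of \<open>\<psi>\<close>. The order of \<open>u\<close> is finite, so
  finitely many derivatives of \<open>\<psi> - h\<close> control \<open>u (\<psi> - h)\<close>, and this tends to \<open>0\<close>.\<close>

lemma distribution_is_fun_if_characters:
  assumes u: "periodic_distribution u" and g: "integrable circle_measure g"
    and eq: "\<And>n. u (char_fun n) = (\<integral>x. g x * char_fun n x \<partial>circle_measure)"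
  shows "distribution_is_fun u g"
  unfolding distribution_is_fun_def
proof (intro conjI allI impI g)
  fix \<psi> assume \<psi>: "test_fun \<psi>"
  have sm: "smooth \<psi>" using \<psi> by (simp add: test_fun_def)
  define v where "v \<phi> = (\<integral>x. g x * \<phi> x \<partial>circle_measure)" for \<phi> :: "real \<Rightarrow> complex"
  have gint: "integrable circle_measure (\<lambda>x. g x * \<phi> x)"
    if "continuous_on UNIV \<phi>" "\<And>x. cmod (\<phi> x) \<le> B" for \<phi> :: "real \<Rightarrow> complex" and B
  proof (rule Bochner_Integration.integrable_bound)
    show "integrable circle_measure (\<lambda>x. B * norm (g x))" using g by simp
    show "(\<lambda>x. g x * \<phi> x) \<in> borel_measurable circle_measure"
      using g integrable_circle_continuous[OF that(1)] by (intro borel_measurable_times) auto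
    have "norm (g x * \<phi> x) \<le> norm (B * norm (g x))" for x
    proof -
      have "cmod (\<phi> x) \<le> \<bar>B\<bar>" using that(2)[of x] by linarith
      from mult_right_mono[OF this, of "norm (g x)"] show ?thesis
        by (simp add: norm_mult abs_mult mult.commute)
    qed
    then show "AE x in circle_measure. norm (g x * \<phi> x) \<le> norm (B * norm (g x))" by simp
  qed
  have gtest: "integrable circle_measure (\<lambda>x. g x * \<phi> x)" if "test_fun \<phi>" for \<phi>
    using periodic_continuous_bounded[of \<phi>] that gint continuous_nth_deriv[of \<phi> UNIV 0] unfolding test_fun_def
    by (metis nth_deriv_0)
  have "\<exists>L. \<forall>m x. m \<ge> 1 \<longrightarrow> cmod (nth_deriv j \<psi> x - nth_deriv j (jackson_poly m \<psi>) x) \<le> L / real m" for j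
    using jackson_poly_approximation[OF \<psi>] by metis
  then obtain L where L: "\<And>j m x. m \<ge> 1 \<Longrightarrow> cmod (nth_deriv j \<psi> x - nth_deriv j (jackson_poly m \<psi>) x) \<le> L j / real m"
    by metis
  obtain N A where NA: "\<And>\<phi>. test_fun \<phi> \<Longrightarrow> norm (u \<phi>) \<le> A * (\<Sum>j\<le>N. SUP x. norm (nth_deriv j \<phi> x))"
    using u unfolding periodic_distribution_def by blast
  have ulin: "\<And>\<psi> \<eta>. test_fun \<psi> \<Longrightarrow> test_fun \<eta> \<Longrightarrow> u (\<lambda>x. \<psi> x + (- 1) * \<eta> x) = u \<psi> - u \<eta>"
  proof -
    fix \<psi> \<eta> assume t: "test_fun \<psi>" "test_fun \<eta>"
    have "test_fun (\<lambda>x. (- 1) * \<eta> x)"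
      using test_fun_lincomb[OF test_fun_trig[of "\<lambda>_. 0" "\<lambda>_. 0" "{}::nat set"] t(2), of "- 1"] by simp
    moreover have "u (\<lambda>x. (- 1) * \<eta> x) = (- 1) * u \<eta>"
      using u t(2) unfolding periodic_distribution_def by blast
    ultimately show "u (\<lambda>x. \<psi> x + (- 1) * \<eta> x) = u \<psi> - u \<eta>"
      using u t(1) unfolding periodic_distribution_def by (metis diff_conv_add_uminus mult_minus1)
  qed
  define D where "D = \<bar>A\<bar> * (\<Sum>j\<le>N. L j) + L 0 * (\<integral>x. norm (g x) \<partial>circle_measure)"
  have bound: "cmod (u \<psi> - v \<psi>) \<le> D / real m" if m: "m \<ge> 1" for m
  proof -
    define h where "h = jackson_poly m \<psi>"
    have h: "test_fun h" unfolding h_def jackson_poly_trig by (rule test_fun_trig)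
    define \<phi> where "\<phi> x = \<psi> x + (- 1) * h x" for x
    have \<phi>: "test_fun \<phi>" unfolding \<phi>_def [abs_def] by (rule test_fun_lincomb[OF \<psi> h])
    have der: "cmod (nth_deriv j \<phi> x) \<le> L j / m" for j x
      using L[OF m, of j x] nth_deriv_lincomb[OF sm, of h j "- 1"] h
      by (simp add: \<phi>_def [abs_def] h_def test_fun_def)
    have "norm (u \<phi>) \<le> A * (\<Sum>j\<le>N. SUP x. norm (nth_deriv j \<phi> x))" by (rule NA[OF \<phi>])
    also have "\<dots> \<le> \<bar>A\<bar> * (\<Sum>j\<le>N. SUP x. norm (nth_deriv j \<phi> x))"
    proof (intro mult_right_mono sum_nonneg abs_ge_self)
      fix j
      have "bdd_above (range (\<lambda>x. cmod (nth_deriv j \<phi> x)))"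
        by (rule bdd_aboveI2[where M="L j / m"]) (rule der)
      then show "0 \<le> (SUP x. cmod (nth_deriv j \<phi> x))"
        by (rule cSUP_upper2[of _ _ "0::real"]) auto
    qed
    also have "\<dots> \<le> \<bar>A\<bar> * (\<Sum>j\<le>N. L j / m)"
      by (intro mult_left_mono sum_mono cSUP_least der) auto
    finally have u\<phi>: "cmod (u \<phi>) \<le> \<bar>A\<bar> * (\<Sum>j\<le>N. L j) / m"
      by (simp flip: sum_divide_distrib)
    have "cmod (v \<phi>) \<le> (\<integral>x. norm (g x * \<phi> x) \<partial>circle_measure)"
      unfolding v_def by (rule integral_norm_bound)
    also have "\<dots> \<le> (\<integral>x. L 0 / m * norm (g x) \<partial>circle_measure)"
    proof (rule integral_mono)
      fix x
      show "norm (g x * \<phi> x) \<le> L 0 / m * norm (g x)"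
        using mult_right_mono[OF der[of 0 x], of "norm (g x)"] by (simp add: norm_mult mult.commute)
    qed (use gtest[OF \<phi>] g in auto)
    finally have v\<phi>: "cmod (v \<phi>) \<le> L 0 * (\<integral>x. norm (g x) \<partial>circle_measure) / m" by simp
    have "u h = v h"
    proof -
      have "u h = (\<Sum>i\<in>{..<2*m-1} \<times> {..<2*m-1}.
        (case i of (i, j) \<Rightarrow> of_real (tent m i * tent m j / jackson_mass m) * fourier_integral \<psi> (int i - int j)) *
         v (char_fun (case i of (i, j) \<Rightarrow> int i - int j)))"
        unfolding h_def jackson_poly_trig by (subst periodic_distribution_trig[OF u]) (auto simp: eq v_def)
      also have "\<dots> = v h"
        unfolding v_def h_def jackson_poly_trig sum_distrib_left
        by (subst Bochner_Integration.integral_sum)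
           (auto intro!: sum.cong integrable_mult_right gtest test_fun_char simp: mult.left_commute[of "g _"])
      finally show ?thesis .
    qed
    moreover have "u \<phi> = u \<psi> - u h" unfolding \<phi>_def [abs_def] by (rule ulin[OF \<psi> h])
    moreover have "v \<phi> = v \<psi> - v h"
      unfolding v_def \<phi>_def using gtest[OF \<psi>] gtest[OF h] by (simp add: right_diff_distrib)
    ultimately have "u \<psi> - v \<psi> = u \<phi> - v \<phi>" by simp
    then have "cmod (u \<psi> - v \<psi>) \<le> cmod (u \<phi>) + cmod (v \<phi>)" by (simp add: norm_triangle_ineq4)
    also have "\<dots> \<le> D / m" using u\<phi> v\<phi> by (simp add: D_def add_divide_distrib)
    finally show ?thesis .
  qed
  have "(\<lambda>m. D / real m) \<longlonglongrightarrow> 0" by (rule lim_const_over_n)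
  then have "cmod (u \<psi> - v \<psi>) \<le> 0"
    by (rule LIMSEQ_le_const) (use bound in blast)
  then show "u \<psi> = (\<integral>x. g x * \<psi> x \<partial>circle_measure)" by (simp add: v_def)
qed

section \<open>Norms and limits\<close>

lemma epowr_ennreal: "0 \<le> b \<Longrightarrow> epowr (ennreal b) a = ennreal (b powr a)"
  by (simp add: epowr_def)

lemma epowr_le:
  assumes "x \<le> ennreal (b powr p)" "0 \<le> b" "1 \<le> p"
  shows "epowr x (1 / p) \<le> ennreal b"
proof -
  from assms(1) have "x < top" using order_le_less_trans ennreal_less_top by blast
  then obtain y where y: "x = ennreal y" "0 \<le> y" by (cases x) auto
  with assms have "y \<le> b powr p" by (simp add: ennreal_le_iff)
  then have "y powr (1 / p) \<le> (b powr p) powr (1 / p)" using y assms by (intro powr_mono2) auto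
  also have "\<dots> = b" using assms by (simp add: powr_powr)
  finally show ?thesis using y by (simp add: epowr_ennreal ennreal_leI)
qed

lemma Fatou_bound:
  fixes h :: "nat \<Rightarrow> 'a \<Rightarrow> ennreal"
  assumes meas: "\<And>i. h i \<in> borel_measurable M"
    and lim: "AE x in M. (\<lambda>i. h i x) \<longlonglongrightarrow> f x"
    and bound: "eventually (\<lambda>i. (\<integral>\<^sup>+x. h i x \<partial>M) \<le> B) sequentially"
  shows "(\<integral>\<^sup>+x. f x \<partial>M) \<le> B"
proof -
  have "(\<integral>\<^sup>+x. f x \<partial>M) = (\<integral>\<^sup>+x. liminf (\<lambda>i. h i x) \<partial>M)"
    using lim by (intro nn_integral_cong_AE) (auto elim!: eventually_mono dest: lim_imp_Liminf[rotated])
  also have "\<dots> \<le> liminf (\<lambda>i. \<integral>\<^sup>+x. h i x \<partial>M)"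
    by (rule nn_integral_liminf) (rule meas)
  also have "\<dots> \<le> liminf (\<lambda>i::nat. B)" by (rule Liminf_mono[OF bound])
  also have "\<dots> = B" by (rule Liminf_const) simp
  finally show ?thesis .
qed

lemma nn_integral_circle_continuous:
  fixes f :: "real \<Rightarrow> real"
  assumes "continuous_on UNIV f" "\<And>x. 0 \<le> f x"
  shows "(\<integral>\<^sup>+x. ennreal (f x) \<partial>circle_measure) = ennreal (integral {0..1} f)"
  using nn_integral_eq_integral[OF integrable_circle_continuous[OF assms(1)]] assms
  by (simp add: integral_circle_continuous)

lemma borel_measurable_lebesgue_continuous:
  fixes f :: "real \<Rightarrow> complex"
  shows "continuous_on UNIV f \<Longrightarrow> f \<in> borel_measurable lebesgue"
  by (intro measurable_completion) (simp add: borel_measurable_continuous_onI)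

lemma borel_measurable_circle: "f \<in> borel_measurable lebesgue \<Longrightarrow> f \<in> borel_measurable circle_measure"
  unfolding circle_measure_def by (rule measurable_restrict_space1)

text \<open>For a continuous function the essential supremum bounds every value, as the set where the bound
  holds is closed and of full measure.\<close>

lemma Linf_norm_bound:
  fixes g :: "real \<Rightarrow> complex"
  assumes per: "periodic1 g" and cont: "continuous_on UNIV g" and fin: "Linf_norm g < top"
  shows "cmod (g x) \<le> enn2real (Linf_norm g)"
proof -
  define C where "C = {x. cmod (g x) \<le> enn2real (Linf_norm g)}"
  have closed: "closed C"
    unfolding C_def by (intro closed_Collect_le continuous_intros cont)
  have "AE x in circle_measure. ennreal (cmod (g x)) \<le> Linf_norm g"
    unfolding Linf_norm_def by (rule esssup_AE)
  then have "AE x in circle_measure. x \<in> C"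
  proof (rule eventually_mono)
    fix x assume le: "ennreal (cmod (g x)) \<le> Linf_norm g"
    show "x \<in> C" using enn2real_mono[OF le fin] by (simp add: C_def)
  qed
  then have "AE x in lebesgue. x \<in> {0..<1} \<longrightarrow> x \<in> C"
    unfolding circle_measure_def by (subst (asm) AE_restrict_space_iff) auto
  then have "AE x\<in>{0<..<1} in lebesgue. x \<in> C"
    by (rule eventually_mono) auto
  then have "{0<..<1} \<subseteq> C"
    by (intro subsetI mem_closed_if_AE_lebesgue_open[OF open_greaterThanLessThan closed])
  then have "closure {0<..<1} \<subseteq> C" using closed by (rule closure_minimal)
  then have "frac x \<in> C" using frac_lt_1[of x] by (auto simp: less_imp_le)
  moreover have "g x = g (frac x)"
    using periodic1_of_int[OF per, of "frac x" "\<lfloor>x\<rfloor>"] by (simp add: frac_def)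
  ultimately show ?thesis by (simp add: C_def)
qed

context dyadic_pieces
begin

definition partial :: "nat \<Rightarrow> real \<Rightarrow> complex" where
  "partial N x = (\<Sum>k<N. piece k x)"

lemma continuous_partial: "continuous_on T (partial N)"
  unfolding partial_def by (intro continuous_intros)

lemma periodic_partial: "periodic1 (partial N)"
  by (simp add: periodic1_def partial_def piece_def char_fun_periodic)

text \<open>A difference of two partial sums is again a sum to which the moment bound applies, with the corresponding
  tail of \<open>\<Sum> a\<^sub>k\<^sup>q\<close>.\<close>

lemma partial_L1_Cauchy:
  assumes q: "1 < q" "q \<le> 2" and summ: "summable (\<lambda>k. a k powr q)" and e: "0 < e"
  obtains N where "\<And>i j. i \<ge> N \<Longrightarrow> j \<ge> N \<Longrightarrow> integral {0..1} (\<lambda>t. cmod (partial i t - partial j t)) \<le> e"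
proof -
  define A where "A = e / (8 * exp 452)"
  have A: "0 < A" using e by (simp add: A_def)
  then obtain N where N: "\<And>m n. m \<ge> N \<Longrightarrow> norm (\<Sum>k=m..<n. a k powr q) < A powr q"
    using summ unfolding summable_Cauchy by (metis powr_gt_zero less_irrefl)
  have le: "integral {0..1} (\<lambda>t. cmod (partial i t - partial j t)) \<le> e" if "N \<le> j" "j \<le> i" for i j
  proof -
    have "partial i t - partial j t = (\<Sum>k\<in>{j..<i}. piece k t)" for t
      unfolding partial_def using that(2)
      by (metis lessThan_atLeast0 sum_diff_nat_ivl zero_le)
    moreover have "integral {0..1} (\<lambda>t. cmod (\<Sum>k\<in>{j..<i}. piece k t) powr 1) \<le> (8 * exp 452 * A * 1 powr (1 - 1 / q)) powr 1"
      by (rule moment_bound) (use q A N[OF that(1), of i] in auto)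
    ultimately show ?thesis using e by (simp add: A_def)
  qed
  have "integral {0..1} (\<lambda>t. cmod (partial i t - partial j t)) \<le> e" if "N \<le> i" "N \<le> j" for i j
    using le[of i j] le[of j i] that by (cases "i \<le> j") (simp_all add: norm_minus_commute)
  with that show ?thesis by blast
qed

text \<open>Fatou's lemma is used twice: for the moments of the limit, and to turn the Cauchy property in
  \<open>L\<^sup>1\<close> into convergence in \<open>L\<^sup>1\<close>.\<close>

lemma limit_function:
  assumes q: "1 < q" "q \<le> 2" and summ: "summable (\<lambda>k. a k powr q)"
  obtains g r where "periodic1 g" "g \<in> borel_measurable lebesgue" "integrable circle_measure g"
    "\<And>p. 1 \<le> p \<Longrightarrow> (\<integral>\<^sup>+x. ennreal (cmod (g x) powr p) \<partial>circle_measure)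
       \<le> ennreal ((8 * exp 452 * (\<Sum>k. a k powr q) powr (1 / q) * p powr (1 - 1 / q)) powr p)"
    "strict_mono r"
    "\<And>n. (\<lambda>i. integral {0..1} (\<lambda>t. partial (r i) t * char_fun n t))
       \<longlonglongrightarrow> (\<integral>t. g t * char_fun n t \<partial>circle_measure)"
proof -
  define A where "A = (\<Sum>k. a k powr q) powr (1 / q)"
  have A: "0 \<le> A" by (simp add: A_def)
  have Aq: "(\<Sum>k. a k powr q) = A powr q"
    using q suminf_nonneg[OF summ] by (simp add: A_def powr_powr)
  have "\<exists>N. \<forall>i\<ge>N. \<forall>j\<ge>N. (LINT x|circle_measure. norm (partial i x - partial j x)) < e" if e: "e > 0" for e
  proof -
    obtain N where "\<And>i j. i \<ge> N \<Longrightarrow> j \<ge> N \<Longrightarrow> integral {0..1} (\<lambda>t. cmod (partial i t - partial j t)) \<le> e / 2"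
      using partial_L1_Cauchy[OF q summ, of "e / 2"] e by auto
    moreover have "(LINT x|circle_measure. norm (partial i x - partial j x)) = integral {0..1} (\<lambda>t. cmod (partial i t - partial j t))" for i j
      by (intro integral_circle_continuous continuous_intros continuous_partial)
    ultimately show ?thesis using e by (intro exI[of _ N]) (auto intro: order_le_less_trans[of _ "e / 2"])
  qed
  with cauchy_L1_AE_cauchy_subseq[of circle_measure partial]
  obtain r where r: "strict_mono r" and cau: "AE x in circle_measure. Cauchy (\<lambda>i. partial (r i) x)"
    using integrable_circle_continuous[OF continuous_partial] by metis
  \<comment> \<open>where the limit does not exist, \<open>lim\<close> has a fixed default value, so \<open>g\<close> is still periodic\<close>
  define g where "g x = lim (\<lambda>i. partial (r i) x)" for x
  have gper: "periodic1 g"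
    using periodic_partial by (simp add: periodic1_def g_def)
  have meas: "partial N \<in> borel_measurable lebesgue" for N
    by (rule borel_measurable_lebesgue_continuous[OF continuous_partial])
  have gmeas: "g \<in> borel_measurable lebesgue"
    unfolding g_def [abs_def] by (intro borel_measurable_lim_metric meas)
  note cmeas = borel_measurable_circle[OF meas] borel_measurable_circle[OF gmeas]
  have lim: "AE x in circle_measure. (\<lambda>i. partial (r i) x) \<longlonglongrightarrow> g x"
    using cau by (rule eventually_mono) (simp add: g_def Cauchy_convergent convergent_LIMSEQ_iff[symmetric])
  have moment: "(\<integral>\<^sup>+x. ennreal (cmod (g x) powr p) \<partial>circle_measure)
       \<le> ennreal ((8 * exp 452 * A * p powr (1 - 1 / q)) powr p)" if p: "1 \<le> p" for p
  proof (rule Fatou_bound[where h = "\<lambda>i x. ennreal (cmod (partial (r i) x) powr p)"])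
    show "(\<lambda>x. ennreal (cmod (partial (r i) x) powr p)) \<in> borel_measurable circle_measure" for i
      using cmeas by measurable
    show "AE x in circle_measure. (\<lambda>i. ennreal (cmod (partial (r i) x) powr p)) \<longlonglongrightarrow> ennreal (cmod (g x) powr p)"
      using lim
    proof (rule eventually_mono)
      fix x assume "(\<lambda>i. partial (r i) x) \<longlonglongrightarrow> g x"
      then show "(\<lambda>i. ennreal (cmod (partial (r i) x) powr p)) \<longlonglongrightarrow> ennreal (cmod (g x) powr p)"
        using p by (intro tendsto_ennrealI tendsto_powr' tendsto_intros) auto
    qed
    have "(\<integral>\<^sup>+x. ennreal (cmod (partial (r i) x) powr p) \<partial>circle_measure)
       \<le> ennreal ((8 * exp 452 * A * p powr (1 - 1 / q)) powr p)" for i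
    proof -
      have "(\<integral>\<^sup>+x. ennreal (cmod (partial (r i) x) powr p) \<partial>circle_measure)
        = ennreal (integral {0..1} (\<lambda>x. cmod (partial (r i) x) powr p))"
        using p by (intro nn_integral_circle_continuous continuous_on_powr' continuous_intros continuous_partial) auto
      also have "\<dots> \<le> ennreal ((8 * exp 452 * A * p powr (1 - 1 / q)) powr p)"
        unfolding partial_def
        by (intro ennreal_leI moment_bound[OF _ q p A])
           (use sum_le_suminf[OF summ, of "{..<r i}"] Aq in auto)
      finally show ?thesis .
    qed
    then show "eventually (\<lambda>i. (\<integral>\<^sup>+x. ennreal (cmod (partial (r i) x) powr p) \<partial>circle_measure)
       \<le> ennreal ((8 * exp 452 * A * p powr (1 - 1 / q)) powr p)) sequentially" by simp
  qed
  have gint: "integrable circle_measure g"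
    using moment[of 1] cmeas(2) by (auto simp: integrable_iff_bounded intro: order_le_less_trans)
  have L1: "(\<lambda>i. (LINT x|circle_measure. norm (partial (r i) x - g x))) \<longlonglongrightarrow> 0"
  proof (rule LIMSEQ_I)
    fix e :: real assume e: "0 < e"
    obtain N where N: "\<And>i j. i \<ge> N \<Longrightarrow> j \<ge> N \<Longrightarrow> integral {0..1} (\<lambda>t. cmod (partial i t - partial j t)) \<le> e / 2"
      using partial_L1_Cauchy[OF q summ, of "e / 2"] e by auto
    have rN: "r i \<ge> N" if "i \<ge> N" for i using seq_suble[OF r, of i] that by linarith
    have "(LINT x|circle_measure. norm (partial (r i) x - g x)) \<le> e / 2" if i: "i \<ge> N" for i
    proof -
      have "(\<integral>\<^sup>+x. ennreal (norm (partial (r i) x - g x)) \<partial>circle_measure) \<le> ennreal (e / 2)"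
      proof (rule Fatou_bound[where h = "\<lambda>j x. ennreal (norm (partial (r i) x - partial (r j) x))"])
        show "(\<lambda>x. ennreal (norm (partial (r i) x - partial (r j) x))) \<in> borel_measurable circle_measure" for j
          using cmeas by measurable
        show "AE x in circle_measure. (\<lambda>j. ennreal (norm (partial (r i) x - partial (r j) x))) \<longlonglongrightarrow> ennreal (norm (partial (r i) x - g x))"
          using lim by (rule eventually_mono) (intro tendsto_ennrealI tendsto_intros)
        have "(\<integral>\<^sup>+x. ennreal (norm (partial (r i) x - partial (r j) x)) \<partial>circle_measure) \<le> ennreal (e / 2)" if "j \<ge> N" for j
          using N[OF rN[OF i] rN[OF that]]
          by (subst nn_integral_circle_continuous) (auto intro!: continuous_intros continuous_partial ennreal_leI)
        then show "eventually (\<lambda>j. (\<integral>\<^sup>+x. ennreal (norm (partial (r i) x - partial (r j) x)) \<partial>circle_measure) \<le> ennreal (e / 2)) sequentially"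
          by (rule eventually_sequentiallyI)
      qed
      moreover have "(\<integral>\<^sup>+x. ennreal (norm (partial (r i) x - g x)) \<partial>circle_measure) = 
          ennreal (LINT x|circle_measure. norm (partial (r i) x - g x))"
        by (intro nn_integral_eq_integral integrable_norm Bochner_Integration.integrable_diff gint
            integrable_circle_continuous[OF continuous_partial]) simp
      ultimately show ?thesis using e by (simp add: ennreal_le_iff)
    qed
    then show "\<exists>N. \<forall>i\<ge>N. norm ((LINT x|circle_measure. norm (partial (r i) x - g x)) - 0) < e"
      using e by (intro exI[of _ N]) (auto intro: order_le_less_trans[of _ "e / 2"])
  qed
  have "(\<lambda>i. integral {0..1} (\<lambda>t. partial (r i) t * char_fun n t))
       \<longlonglongrightarrow> (\<integral>t. g t * char_fun n t \<partial>circle_measure)" for n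
  proof -
    have ge: "integrable circle_measure (\<lambda>t. g t * char_fun n t)"
    proof (rule Bochner_Integration.integrable_bound[OF gint])
      have "char_fun n \<in> borel_measurable circle_measure"
        by (intro borel_measurable_circle borel_measurable_lebesgue_continuous continuous_on_char_fun)
      then show "(\<lambda>t. g t * char_fun n t) \<in> borel_measurable circle_measure"
        using cmeas(2) by measurable
    qed (simp add: norm_mult)
    have "norm (integral {0..1} (\<lambda>t. partial (r i) t * char_fun n t) - (\<integral>t. g t * char_fun n t \<partial>circle_measure))
      \<le> (LINT x|circle_measure. norm (partial (r i) x - g x))" for i
    proof -
      have pe: "continuous_on UNIV (\<lambda>t. partial (r i) t * char_fun n t)"
        by (intro continuous_intros continuous_partial)
      have "integral {0..1} (\<lambda>t. partial (r i) t * char_fun n t) - (\<integral>t. g t * char_fun n t \<partial>circle_measure)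
        = (\<integral>t. partial (r i) t * char_fun n t - g t * char_fun n t \<partial>circle_measure)"
        using integrable_circle_continuous[OF pe] ge integral_circle_continuous[OF pe] by simp
      also have "(\<lambda>t. partial (r i) t * char_fun n t - g t * char_fun n t) = (\<lambda>t. (partial (r i) t - g t) * char_fun n t)"
        by (simp add: left_diff_distrib)
      finally show ?thesis
        using integral_norm_bound[of circle_measure "\<lambda>t. (partial (r i) t - g t) * char_fun n t"]
        by (simp add: norm_mult)
    qed
    then have "(\<lambda>i. integral {0..1} (\<lambda>t. partial (r i) t * char_fun n t) - (\<integral>t. g t * char_fun n t \<partial>circle_measure)) \<longlonglongrightarrow> 0"
      by (intro Lim_null_comparison[OF _ L1] always_eventually allI)
    then show ?thesis by (rule LIM_zero_cancel)
  qed
  with that[OF gper gmeas gint _ r] moment show thesis unfolding A_def by blast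
qed

lemma integral_piece_char: "integral {0..1} (\<lambda>t. piece k t * char_fun n t) = (if - n \<in> dyadic_block k then c k (- n) else 0)"
proof -
  have "integral {0..1} (\<lambda>t. piece k t * char_fun n t) = 
     integral {0..1} (\<lambda>t. \<Sum>l\<in>dyadic_block k. c k l * char_fun (l + n) t)"
    by (simp add: piece_def sum_distrib_right char_fun_add mult.assoc)
  also have "\<dots> = (\<Sum>l\<in>dyadic_block k. c k l * integral {0..1} (char_fun (l + n)))"
    by (subst integral_sum) (auto intro!: integrable_continuous_interval continuous_intros)
  also have "\<dots> = (\<Sum>l\<in>dyadic_block k. if l = - n then c k (- n) else 0)"
    by (intro sum.cong refl) (auto simp: integral_char_fun)
  finally show ?thesis by simp
qed

lemma integral_partial_char:
  assumes "\<And>k n. n \<notin> dyadic_block k \<Longrightarrow> c k n = 0"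
  shows "integral {0..1} (\<lambda>t. partial N t * char_fun n t) = (\<Sum>k<N. c k (- n))"
proof -
  have "integral {0..1} (\<lambda>t. partial N t * char_fun n t) = (\<Sum>k<N. integral {0..1} (\<lambda>t. piece k t * char_fun n t))"
    unfolding partial_def sum_distrib_right
    by (intro integral_sum integrable_continuous_interval continuous_intros) simp
  then show ?thesis using assms by (auto simp: integral_piece_char intro!: sum.cong)
qed

end

section \<open>Littlewood-Paley pieces and the embedding\<close>

lemma admissible_cutoff_eq_0:
  assumes "admissible_cutoff \<Phi>" "2 \<le> \<bar>s\<bar>"
  shows "\<Phi> s = 0"
proof (rule ccontr)
  assume "\<Phi> s \<noteq> 0"
  then have "s \<in> closure {s. \<Phi> s \<noteq> 0}" by (intro subsetD[OF closure_subset]) simp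
  moreover have "closure {s. \<Phi> s \<noteq> 0} \<subseteq> {-2<..<2}"
    using assms(1) unfolding admissible_cutoff_def by (elim conjE)
  ultimately have "s \<in> {-2<..<2}" by (rule rev_subsetD)
  then show False using assms(2) by auto
qed

lemma admissible_cutoff_eq_1: "admissible_cutoff \<Phi> \<Longrightarrow> \<bar>s\<bar> \<le> 1 \<Longrightarrow> \<Phi> s = 1"
  unfolding admissible_cutoff_def by blast

lemma dyadic_cutoff_0: "dyadic_cutoff \<Phi> 0 s = \<Phi> s"
  by (simp add: dyadic_cutoff_def)

lemma dyadic_cutoff_Suc: "dyadic_cutoff \<Phi> (Suc k) s = \<Phi> (s / 2 ^ Suc k) - \<Phi> (s / 2 ^ k)"
proof -
  have "(2::real) powi (- int (Suc k)) = 1 / 2 ^ Suc k"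
    by (simp only: power_int_minus power_int_of_nat) (rule inverse_eq_divide)
  moreover have "- int (Suc k) + 1 = - int k" by simp
  then have "(2::real) powi (- int (Suc k) + 1) = 1 / 2 ^ k"
    by (simp only: power_int_minus power_int_of_nat) (rule inverse_eq_divide)
  ultimately show ?thesis by (simp only: dyadic_cutoff_def) simp
qed

text \<open>The telescoping sum shows that the partial sums of the pieces are smooth truncations of the Fourier series,
  which leave every fixed frequency untouched from some stage on.\<close>

lemma sum_dyadic_cutoff: "(\<Sum>k<Suc N. dyadic_cutoff \<Phi> k s) = \<Phi> (s / 2 ^ N)"
proof (induction N)
  case (Suc N)
  then show ?case by (simp only: sum.lessThan_Suc[of _ "Suc N"] dyadic_cutoff_Suc) simp
qed (simp add: dyadic_cutoff_0)

lemma dyadic_cutoff_outside_block: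
  assumes "admissible_cutoff \<Phi>" "n \<notin> dyadic_block k"
  shows "dyadic_cutoff \<Phi> k (of_int n) = 0"
proof (cases k)
  case 0
  then have "2 < \<bar>n\<bar>" using assms by (auto simp: dyadic_block_def)
  then have "2 \<le> \<bar>real_of_int n\<bar>" by linarith
  with 0 show ?thesis by (simp add: dyadic_cutoff_0 admissible_cutoff_eq_0[OF assms(1)])
next
  case (Suc j)
  then consider "2 ^ (Suc j + 1) < \<bar>n\<bar>" | "\<bar>n\<bar> < 2 ^ j" using assms by (force simp: dyadic_block_def)
  then show ?thesis
  proof cases
    case 1
    then have "real_of_int (2 ^ (Suc j + 1)) \<le> real_of_int \<bar>n\<bar>" by (simp only: of_int_le_iff less_imp_le)
    then have "2 * 2 ^ Suc j \<le> real_of_int \<bar>n\<bar>" by simp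
    then have "2 \<le> \<bar>real_of_int n / 2 ^ Suc j\<bar>" "2 \<le> \<bar>real_of_int n / 2 ^ j\<bar>"
      by (auto simp: abs_divide field_simps)
    then show ?thesis using Suc by (simp only: dyadic_cutoff_Suc admissible_cutoff_eq_0[OF assms(1)]) simp
  next
    case 2
    then have "real_of_int \<bar>n\<bar> \<le> real_of_int (2 ^ j)" by (simp only: of_int_le_iff less_imp_le)
    then have "real_of_int \<bar>n\<bar> \<le> 2 ^ j" by simp
    then have "\<bar>real_of_int n / 2 ^ Suc j\<bar> \<le> 1" "\<bar>real_of_int n / 2 ^ j\<bar> \<le> 1"
      by (auto simp: abs_divide field_simps)
    then show ?thesis using Suc by (simp only: dyadic_cutoff_Suc admissible_cutoff_eq_1[OF assms(1)]) simp
  qed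
qed

lemma LP_piece_eq:
  assumes "admissible_cutoff \<Phi>"
  shows "LP_piece \<Phi> k u x = (\<Sum>n\<in>dyadic_block k. dyadic_cutoff \<Phi> k (of_int n) * fourier_coeff u n * char_fun n x)"
proof -
  have "LP_piece \<Phi> k u x = (\<Sum>\<^sub>\<infinity>n\<in>dyadic_block k. dyadic_cutoff \<Phi> k (of_int n) * fourier_coeff u n * char_fun n x)"
    unfolding LP_piece_def by (rule infsum_cong_neutral) (auto simp: dyadic_cutoff_outside_block[OF assms])
  then show ?thesis by simp
qed

lemma besov_space_lq:
  assumes u: "u \<in> besov_space \<Phi> q" and q: "1 < q"
  defines "a \<equiv> \<lambda>k. enn2real (Linf_norm (LP_piece \<Phi> k u))"
  shows "Linf_norm (LP_piece \<Phi> k u) < top" "summable (\<lambda>k. a k powr q)"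
    "besov_norm \<Phi> q u = ennreal ((\<Sum>k. a k powr q) powr (1 / q))"
proof -
  have fin: "(\<Sum>k. epowr (Linf_norm (LP_piece \<Phi> k u)) q) < top"
    using u by (auto simp: besov_space_def besov_norm_def epowr_def less_top split: if_splits)
  have each: "Linf_norm (LP_piece \<Phi> k u) < top" for k
  proof (rule ccontr)
    assume "\<not> ?thesis"
    then have "epowr (Linf_norm (LP_piece \<Phi> k u)) q = top" by (simp add: epowr_def less_top)
    moreover have "epowr (Linf_norm (LP_piece \<Phi> k u)) q \<le> (\<Sum>k. epowr (Linf_norm (LP_piece \<Phi> k u)) q)"
      using sum_le_suminf[OF summableI, of "{k}" "\<lambda>k. epowr (Linf_norm (LP_piece \<Phi> k u)) q"] by simp
    ultimately show False using fin by (simp add: top_unique)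
  qed
  then show "Linf_norm (LP_piece \<Phi> k u) < top" .
  have eq: "epowr (Linf_norm (LP_piece \<Phi> k u)) q = ennreal (a k powr q)" for k
    using each[of k] by (simp add: epowr_def a_def less_top)
  show s: "summable (\<lambda>k. a k powr q)"
    using fin by (intro summable_suminf_not_top) (auto simp: eq less_top)
  show "besov_norm \<Phi> q u = ennreal ((\<Sum>k. a k powr q) powr (1 / q))"
    using s by (simp add: besov_norm_def eq suminf_ennreal2 epowr_ennreal suminf_nonneg)
qed

theorem theorem1p1:
  fixes \<Phi> :: "real \<Rightarrow> complex" and q :: real
  assumes "admissible_cutoff \<Phi>" and "1 < q" and "q \<le> 2"
  shows "\<exists>C::real. \<forall>u\<in>besov_space \<Phi> q. \<exists>g\<in>expL (q / (q - 1)).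
           distribution_is_fun u g \<and>
           expL_norm (q / (q - 1)) g \<le> ennreal C * besov_norm \<Phi> q u"
proof (intro exI[of _ "8 * exp 452"] ballI)
  fix u assume u: "u \<in> besov_space \<Phi> q"
  define a where "a k = enn2real (Linf_norm (LP_piece \<Phi> k u))" for k
  define c where "c k n = dyadic_cutoff \<Phi> k (of_int n) * fourier_coeff u n" for k n
  define A where "A = (\<Sum>k. a k powr q) powr (1 / q)"
  have A: "0 \<le> A" by (simp add: A_def)
  note lq = besov_space_lq[OF u assms(2), folded a_def]
  have LP: "LP_piece \<Phi> k u = (\<lambda>x. \<Sum>n\<in>dyadic_block k. c k n * char_fun n x)" for k
    by (simp add: LP_piece_eq[OF assms(1)] c_def fun_eq_iff)
  interpret dyadic_pieces c a "\<lambda>k x. \<Sum>n\<in>dyadic_block k. c k n * char_fun n x"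
    "\<lambda>k x. \<Sum>n\<in>dyadic_block k. c k n * char_primitive n x"
  proof unfold_locales
    fix k x
    have "periodic1 (LP_piece \<Phi> k u)" by (simp add: LP periodic1_def char_fun_periodic)
    moreover have "continuous_on UNIV (LP_piece \<Phi> k u)" unfolding LP by (intro continuous_intros)
    ultimately have "cmod (LP_piece \<Phi> k u x) \<le> a k"
      unfolding a_def by (rule Linf_norm_bound) (rule lq(1))
    then show "cmod (\<Sum>n\<in>dyadic_block k. c k n * char_fun n x) \<le> a k" by (simp add: LP)
  qed
  obtain g r where g: "periodic1 g" "g \<in> borel_measurable lebesgue" "integrable circle_measure g"
    and moment: "\<And>p. 1 \<le> p \<Longrightarrow> (\<integral>\<^sup>+x. ennreal (cmod (g x) powr p) \<partial>circle_measure)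
       \<le> ennreal ((8 * exp 452 * A * p powr (1 - 1 / q)) powr p)"
    and r: "strict_mono r"
    and lim: "\<And>n. (\<lambda>i. integral {0..1} (\<lambda>t. partial (r i) t * char_fun n t))
       \<longlonglongrightarrow> (\<integral>t. g t * char_fun n t \<partial>circle_measure)"
    using limit_function[OF assms(2,3) lq(2)] unfolding A_def by blast
  \<comment> \<open>for \<open>\<bar>n\<bar> \<le> 2\<^sup>N\<close> the truncation at stage \<open>N\<close> retains the coefficient of the character \<open>-n\<close>\<close>
  have "u (char_fun n) = (\<integral>t. g t * char_fun n t \<partial>circle_measure)" for n
  proof (rule LIMSEQ_unique[OF _ lim])
    have "integral {0..1} (\<lambda>t. partial (r i) t * char_fun n t) = u (char_fun n)" if i: "i \<ge> nat \<bar>n\<bar> + 1" for i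
    proof -
      have "r i \<ge> nat \<bar>n\<bar> + 1" using seq_suble[OF r, of i] i by linarith
      then obtain N where N: "r i = Suc N" "nat \<bar>n\<bar> \<le> N" by (cases "r i") auto
      have "real_of_int \<bar>n\<bar> \<le> real N" using N(2) by linarith
      also have "\<dots> \<le> 2 ^ N" using of_nat_less_two_power[of N, where 'a=real] by linarith
      finally have "\<bar>real_of_int (- n) / 2 ^ N\<bar> \<le> 1" by (simp add: abs_divide)
      then have "\<Phi> (real_of_int (- n) / 2 ^ N) = 1" by (rule admissible_cutoff_eq_1[OF assms(1)])
      moreover have "integral {0..1} (\<lambda>t. partial (r i) t * char_fun n t) = (\<Sum>k<r i. c k (- n))"
        by (rule integral_partial_char) (simp add: c_def dyadic_cutoff_outside_block[OF assms(1)])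
      ultimately show ?thesis
        unfolding N(1) c_def sum_distrib_right[symmetric] sum_dyadic_cutoff by (simp add: fourier_coeff_def)
    qed
    then show "(\<lambda>i. integral {0..1} (\<lambda>t. partial (r i) t * char_fun n t)) \<longlonglongrightarrow> u (char_fun n)"
      by (intro tendsto_eventually eventually_sequentiallyI)
  qed
  moreover have "periodic_distribution u" using u by (simp add: besov_space_def)
  ultimately have dist: "distribution_is_fun u g"
    using distribution_is_fun_if_characters g(3) by blast
  have Lp: "ennreal (p powr (- 1 / (q / (q - 1)))) * Lp_norm p g \<le> ennreal (8 * exp 452 * A)" if p: "1 \<le> p" for p
  proof -
    have "Lp_norm p g \<le> ennreal (8 * exp 452 * A * p powr (1 - 1 / q))"
      unfolding Lp_norm_def using moment[OF p] A p by (intro epowr_le) auto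
    then have "ennreal (p powr (- 1 / (q / (q - 1)))) * Lp_norm p g
       \<le> ennreal (p powr (- 1 / (q / (q - 1)))) * ennreal (8 * exp 452 * A * p powr (1 - 1 / q))"
      by (rule mult_left_mono) simp
    also have "\<dots> = ennreal (8 * exp 452 * A * (p powr (- 1 / (q / (q - 1))) * p powr (1 - 1 / q)))"
      by (simp add: mult_ac flip: ennreal_mult')
    also have "p powr (- 1 / (q / (q - 1))) * p powr (1 - 1 / q) = p powr (- 1 / (q / (q - 1)) + (1 - 1 / q))"
      by (rule powr_add[symmetric])
    also have "- 1 / (q / (q - 1)) + (1 - 1 / q) = 0"
      using assms(2) by (simp add: field_simps)
    finally show ?thesis using p by simp
  qed
  have norm: "expL_norm (q / (q - 1)) g \<le> ennreal (8 * exp 452) * besov_norm \<Phi> q u"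
  proof -
    have "expL_norm (q / (q - 1)) g \<le> ennreal (8 * exp 452 * A)"
      unfolding expL_norm_def by (rule SUP_least) (use Lp in auto)
    also have "\<dots> = ennreal (8 * exp 452) * besov_norm \<Phi> q u"
      unfolding lq(3) A_def[symmetric] by (rule ennreal_mult) (use A in auto)
    finally show ?thesis .
  qed
  have "besov_norm \<Phi> q u < top" using u by (simp add: besov_space_def)
  with norm have "expL_norm (q / (q - 1)) g < top"
    by (auto intro: order_le_less_trans simp: ennreal_mult_less_top)
  with g have "g \<in> expL (q / (q - 1))" by (simp add: expL_def)
  with dist norm show "\<exists>g\<in>expL (q / (q - 1)). distribution_is_fun u g \<and>
           expL_norm (q / (q - 1)) g \<le> ennreal (8 * exp 452) * besov_norm \<Phi> q u" by blast
qed

end
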